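(* For every real number $a>0$, $$\pi^2\, m\big((1+w)(1+x)+a(1-w)(1-x)y\big)=4\,\mathcal{L}^a_3(1)-2\,\mathcal{L}^a_{2:1}(1),$$ where the polynomial is in the three variables $w,x,y$.
   Context: The (logarithmic) Mahler measure of a nonzero polynomial $P\in\mathbb{C}[x_1,\dots,x_n]$ is $m(P)=\frac{1}{(2\pi i)^n}\int_{\mathbb{T}^n}\log|P(x_1,\dots,x_n)|\,\frac{dx_1}{x_1}\cdots\frac{dx_n}{x_n}$, with $\mathbb{T}^n=\{|x_1|=\dots=|x_n|=1\}$. $\mathrm{Li}_r(x)=\sum_{k\ge1}x^k/k^r$ for $|x|<1$, extended by analytic continuation through the iterated integral $\mathrm{Li}_r(x)=-\int_{0\le t_1\le\dots\le t_r\le1}\frac{dt_1}{t_1-1/x}\frac{dt_2}{t_2}\cdots\frac{dt_r}{t_r}$, taken along the real segment $[0,1]$ when $1/x\notin(0,1)$. When the singularity $1/x$ lies in $(0,1)$ (which happens here for $a>1$), all the integrals are taken along the path $\gamma(\theta)=\frac{e^{i\theta}+1}{2}$, $-\pi\le\theta\le0$, from $0$ to $1$ (with the same branch for all terms). For real $a\ne0$ and complex $x$: $\mathcal{L}^a_r(x):=\mathrm{Li}_r(xa)-\mathrm{Li}_r(-xa)$ and $\mathcal{L}^a_{r:1}(x):=\log|a|\,\big(\mathrm{Li}_r(xa)-\mathrm{Li}_r(-xa)\big)$. *)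

theory Defs
  imports
    "HOL-Complex_Analysis.Complex_Analysis"
    "HOL-Library.Poly_Mapping"
begin

text \<open>Polynomials over the complex numbers in variables indexed by a finite type: finitely
  supported maps from exponent vectors to coefficients, with the ring structure of
  \<^theory>\<open>HOL-Library.Poly_Mapping\<close>.\<close>

type_synonym 'n cpoly = "('n \<Rightarrow>\<^sub>0 nat) \<Rightarrow>\<^sub>0 complex"

definition Const :: "complex \<Rightarrow> 'n cpoly" where
  "Const c = Poly_Mapping.single 0 c"

definition Var :: "'n \<Rightarrow> 'n cpoly" where
  "Var i = Poly_Mapping.single (Poly_Mapping.single i 1) 1"

definition eval_cpoly :: "('n \<Rightarrow> complex) \<Rightarrow> 'n cpoly \<Rightarrow> complex" where
  "eval_cpoly z P = (\<Sum>m\<in>Poly_Mapping.keys P.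
     Poly_Mapping.lookup P m * (\<Prod>i\<in>Poly_Mapping.keys m. z i ^ Poly_Mapping.lookup m i))"

lemma eval_cpoly_single:
  "eval_cpoly z (Poly_Mapping.single m c) =
     c * (\<Prod>i\<in>Poly_Mapping.keys m. z i ^ Poly_Mapping.lookup m i)"
  by (simp add: eval_cpoly_def)

lemma eval_cpoly_Const [simp]: "eval_cpoly z (Const c) = c"
  by (simp add: Const_def eval_cpoly_single)

lemma eval_cpoly_Var [simp]: "eval_cpoly z (Var i) = z i"
  by (simp add: Var_def eval_cpoly_single)

lemma eval_cpoly_0 [simp]: "eval_cpoly z 0 = 0"
  by (simp add: eval_cpoly_def)

lemma eval_cpoly_1 [simp]: "eval_cpoly z 1 = 1"
  by (simp flip: single_one add: eval_cpoly_single)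

lemma eval_cpoly_superset:
  assumes "finite A" "Poly_Mapping.keys P \<subseteq> A"
  shows "eval_cpoly z P = (\<Sum>m\<in>A. Poly_Mapping.lookup P m *
           (\<Prod>i\<in>Poly_Mapping.keys m. z i ^ Poly_Mapping.lookup m i))"
  unfolding eval_cpoly_def using assms
  by (intro sum.mono_neutral_left) (auto simp: in_keys_iff)

lemma eval_cpoly_add [simp]: "eval_cpoly z (P + Q) = eval_cpoly z P + eval_cpoly z Q"
proof -
  let ?A = "Poly_Mapping.keys P \<union> Poly_Mapping.keys Q"
  have "Poly_Mapping.keys (P + Q) \<subseteq> ?A" by (rule Poly_Mapping.keys_add)
  thus ?thesis
    by (simp add: eval_cpoly_superset [of ?A] lookup_add sum.distrib distrib_right)
qed

lemma eval_cpoly_uminus [simp]: "eval_cpoly z (- P) = - eval_cpoly z P"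
  by (rule minus_unique [symmetric]) (simp flip: eval_cpoly_add)

lemma eval_cpoly_diff [simp]: "eval_cpoly z (P - Q) = eval_cpoly z P - eval_cpoly z Q"
  using eval_cpoly_add [of z P "- Q"] by simp

lemma eval_cpoly_mult_single:
  "eval_cpoly z (Poly_Mapping.single m c * Poly_Mapping.single n d) =
     eval_cpoly z (Poly_Mapping.single m c) * eval_cpoly z (Poly_Mapping.single n d)"
proof -
  let ?A = "Poly_Mapping.keys m \<union> Poly_Mapping.keys n"
  have *: "(\<Prod>i\<in>Poly_Mapping.keys k. z i ^ Poly_Mapping.lookup k i) =
             (\<Prod>i\<in>?A. z i ^ Poly_Mapping.lookup k i)"
    if "Poly_Mapping.keys k \<subseteq> ?A" for k
    using that by (intro prod.mono_neutral_left) (auto simp: in_keys_iff)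
  have "Poly_Mapping.keys (m + n) \<subseteq> ?A" by (rule Poly_Mapping.keys_add)
  from * [OF this] * [of m] * [of n] show ?thesis
    by (simp only: mult_single eval_cpoly_single Un_upper1 Un_upper2 simp_thms)
       (simp add: lookup_add power_add prod.distrib)
qed

lemma cpoly_eq_sum_single:
  "P = (\<Sum>m\<in>Poly_Mapping.keys P. Poly_Mapping.single m (Poly_Mapping.lookup P m))"
proof (rule poly_mapping_eqI)
  fix k
  have "Poly_Mapping.lookup
          (\<Sum>m\<in>Poly_Mapping.keys P. Poly_Mapping.single m (Poly_Mapping.lookup P m)) k =
        (\<Sum>m\<in>Poly_Mapping.keys P. if m = k then Poly_Mapping.lookup P m else 0)"
    by (simp add: lookup_sum lookup_single when_def)
  also have "\<dots> = Poly_Mapping.lookup P k"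
    by (simp add: in_keys_iff)
  finally show "Poly_Mapping.lookup P k = Poly_Mapping.lookup
      (\<Sum>m\<in>Poly_Mapping.keys P. Poly_Mapping.single m (Poly_Mapping.lookup P m)) k" ..
qed

lemma eval_cpoly_sum: "eval_cpoly z (\<Sum>i\<in>I. f i) = (\<Sum>i\<in>I. eval_cpoly z (f i))"
  by (induction I rule: infinite_finite_induct) auto

lemma eval_cpoly_mult [simp]: "eval_cpoly z (P * Q) = eval_cpoly z P * eval_cpoly z Q"
proof -
  have "eval_cpoly z ((\<Sum>m\<in>A. Poly_Mapping.single m (f m)) *
                      (\<Sum>n\<in>B. Poly_Mapping.single n (g n))) =
        eval_cpoly z (\<Sum>m\<in>A. Poly_Mapping.single m (f m)) *
        eval_cpoly z (\<Sum>n\<in>B. Poly_Mapping.single n (g n))" for A B f g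
    by (simp add: sum_product eval_cpoly_sum eval_cpoly_mult_single)
  from this [where A = "Poly_Mapping.keys P" and f = "Poly_Mapping.lookup P"
      and B = "Poly_Mapping.keys Q" and g = "Poly_Mapping.lookup Q"]
  show ?thesis
    unfolding cpoly_eq_sum_single [symmetric] .
qed

text \<open>With \<open>x\<^sub>j = cis \<theta>\<^sub>j\<close> one has \<open>dx\<^sub>j / x\<^sub>j = \<i> d\<theta>\<^sub>j\<close>, which turns the prefactor
  \<open>(2 \<pi> \<i>)\<^sup>-\<^sup>n\<close> into \<open>(2 \<pi>)\<^sup>-\<^sup>n\<close>. The zero set of a nonzero polynomial is null on the
  torus, so the convention \<open>ln 0 = 0\<close> does not affect the integral. The value at the zero
  polynomial is meaningless.\<close>

definition mahler_measure :: "'n::finite cpoly \<Rightarrow> real" where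
  "mahler_measure P = 1 / (2 * pi) ^ CARD('n) *
     (LINT \<theta> : (UNIV \<rightarrow>\<^sub>E {0..2 * pi}) | (\<Pi>\<^sub>M i\<in>(UNIV :: 'n set). lborel).
        ln (norm (eval_cpoly (\<lambda>j. cis (\<theta> j)) P)))"

text \<open>Iterated integral along the part of the path \<open>\<gamma>\<close> with parameters in \<open>[0, s]\<close>; the head of
  the list is the outermost form, so that \<open>iterated_integral \<gamma> [f\<^sub>r, \<dots>, f\<^sub>1] 1\<close> is the
  integral of \<open>f\<^sub>1(t\<^sub>1) dt\<^sub>1 \<dots> f\<^sub>r(t\<^sub>r) dt\<^sub>r\<close> over \<open>t\<^sub>1, \<dots>, t\<^sub>r\<close> in this order on \<open>\<gamma>\<close>.\<close>

primrec iterated_integral ::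
    "(real \<Rightarrow> complex) \<Rightarrow> (complex \<Rightarrow> complex) list \<Rightarrow> real \<Rightarrow> complex" where
  "iterated_integral \<gamma> [] s = 1"
| "iterated_integral \<gamma> (f # fs) s =
     integral {0..s} (\<lambda>u. f (\<gamma> u) * vector_derivative \<gamma> (at u within {0..1}) *
       iterated_integral \<gamma> fs u)"

text \<open>The polylogarithm of weight \<open>r \<ge> 1\<close>, continued outside the unit disc along a path \<open>\<gamma>\<close> from
  0 to 1 that avoids \<open>1 / z\<close> (except possibly at its endpoint, when \<open>r \<ge> 2\<close>).\<close>

definition polylog :: "(real \<Rightarrow> complex) \<Rightarrow> nat \<Rightarrow> complex \<Rightarrow> complex" where
  "polylog \<gamma> r z =
     (if norm z < 1 then suminf (\<lambda>k. z ^ Suc k / of_nat (Suc k) ^ r)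
      else - iterated_integral \<gamma> (replicate (r - 1) (\<lambda>t. 1 / t) @ [\<lambda>t. 1 / (t - 1 / z)]) 1)"

text \<open>The path used for both \<open>polylog\<close> at \<open>z\<close> and at \<open>- z\<close>. The detour is
  \<open>(exp (\<i> \<theta>) + 1) / 2\<close> for \<open>\<theta>\<close> running from \<open>- \<pi>\<close> to \<open>0\<close>.\<close>

definition polylog_path :: "complex \<Rightarrow> real \<Rightarrow> complex" where
  "polylog_path z =
     (if 1 / z \<in> complex_of_real ` {0<..<1} \<or> 1 / (- z) \<in> complex_of_real ` {0<..<1}
      then part_circlepath (1/2) (1/2) (- pi) 0
      else linepath 0 1)"

lemma polylog_path_of_real:
  assumes "a > 0"
  shows "polylog_path (of_real a) =
    (if a > 1 then part_circlepath (1/2) (1/2) (- pi) 0 else linepath 0 1)"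
proof -
  have "complex_of_real r \<in> complex_of_real ` {0<..<1} \<longleftrightarrow> 0 < r \<and> r < 1" for r
    by auto
  from this [of "1 / a"] this [of "1 / - a"] show ?thesis
    using assms by (simp add: polylog_path_def divide_less_0_iff)
qed

text \<open>These are \<open>\<L>\<^sup>a\<^sub>r(x)\<close> and \<open>\<L>\<^sup>a\<^sub>r\<^sub>:\<^sub>1(x)\<close>, for real \<open>a \<noteq> 0\<close>.\<close>

definition odd_polylog :: "real \<Rightarrow> nat \<Rightarrow> complex \<Rightarrow> complex" where
  "odd_polylog a r x =
     (let \<gamma> = polylog_path (x * of_real a)
      in polylog \<gamma> r (x * of_real a) - polylog \<gamma> r (- x * of_real a))"

definition odd_polylog_log :: "real \<Rightarrow> nat \<Rightarrow> complex \<Rightarrow> complex" where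
  "odd_polylog_log a r x =
     (let \<gamma> = polylog_path (x * of_real a)
      in of_real (ln \<bar>a\<bar>) * (polylog \<gamma> r (x * of_real a) - polylog \<gamma> r (- x * of_real a)))"

end

theory Submission
  imports Defs
begin

text \<open>
  Both sides equal \<open>4 F(a)\<close>, where \<open>F(a)\<close> is the integral over \<open>[0,1]\<close> of the nonnegative kernel
  \<open>a ln t (ln a + ln t) / (1 - a\<^sup>2 t\<^sup>2)\<close>. At \<open>t = 1/a\<close> the factor \<open>ln a + ln t = ln (a t)\<close>
  vanishes together with the denominator, so the singularity is removable. For this reason the formula
  for \<open>a > 1\<close> is the same as for \<open>a < 1\<close>: the chosen combination of polylogarithms has a
  continuation that is real and does not depend on the side on which the path passes \<open>1/a\<close>.

  Mahler measure. In \<open>y\<close> the polynomial is linear, \<open>A + B y\<close>, and the mean of \<open>ln |A + B y|\<close> over the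
  circle is \<open>ln (max |A| |B|)\<close> (\<open>ln_norm_circle_linear\<close>). For \<open>w = cis s\<close> and \<open>x = cis t\<close> one has
  \<open>|A| = |1 + w| |1 + x|\<close> and \<open>|B| / |A| = a |tan (s/2) tan (t/2)|\<close>. The mean of \<open>ln |1 + w|\<close> is zero, so
  there remains the mean of \<open>ln (max 1 (a |tan (s/2) tan (t/2)|))\<close>. With \<open>u\<close> and \<open>v\<close> the absolute
  cotangents, of density proportional to \<open>1 / (1 + u\<^sup>2)\<close>, and \<open>r = u v\<close>, the integral of
  \<open>u / ((1 + u\<^sup>2) (u\<^sup>2 + r\<^sup>2))\<close> over \<open>u\<close> is \<open>ln r / (r\<^sup>2 - 1)\<close>, and \<open>r = a t\<close> gives \<open>F(a)\<close>
  (\<open>nn_integral_log_plus_plane\<close>). All integrands are made nonnegative by subtracting from a constant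
  upper bound of \<open>ln |P|\<close>, so that Tonelli's theorem applies and integrability comes out of the
  computation.

  Polylogarithms. For \<open>a < 1\<close> the geometric series for \<open>1 / (1 - a\<^sup>2 t\<^sup>2)\<close> is integrated term by term.
  For \<open>a \<ge> 1\<close>, integrating the forms \<open>dt/t\<close> first turns the iterated integrals into
  \<open>Li\<^sub>2(z) = \<integral> Log t / (t - 1/z) dt\<close> and \<open>Li\<^sub>3(z) = -1/2 \<integral> (Log t)\<^sup>2 / (t - 1/z) dt\<close> along the same path
  (\<open>polylog_eq_single_integral\<close>). Inserting \<open>z = a\<close> and \<open>z = -a\<close>, the partial fractions combine to four
  times the integral of the kernel along the path. For \<open>a = 1\<close> the path is the segment itself. For
  \<open>a > 1\<close> the kernel is holomorphic on the right half-plane, also at \<open>1/a\<close>, and Cauchy's theorem moves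
  the semicircle back to the segment (\<open>semicircle_deform\<close>).
\<close>

section \<open>The logarithmic kernel\<close>

text \<open>At the removable singularity \<open>t = 1/a\<close> the value is \<open>0\<close>, since division by zero yields zero. This
differs from the continuous extension but not for integration.\<close>

definition log_kernel :: "real \<Rightarrow> real \<Rightarrow> real" where
  "log_kernel a t = a * ln t * (ln a + ln t) / (1 - a\<^sup>2 * t\<^sup>2)"

lemma ln_over_sq_minus_1_nonneg: "s > 0 \<Longrightarrow> ln s / (s\<^sup>2 - 1) \<ge> (0::real)"
proof -
  assume s: "s > 0"
  show ?thesis
  proof (cases "s \<ge> 1")
    case True
    then have "s\<^sup>2 \<ge> 1" by (simp add: one_le_power)
    with True show ?thesis by simp
  next
    case False
    then have "s\<^sup>2 \<le> 1" using s by (simp add: power_le_one)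
    with False s show ?thesis by (intro divide_nonpos_nonpos) auto
  qed
qed

text \<open>In this form the kernel is a product of nonnegative factors on \<open>{0<..1}\<close>, the last one being a
function of \<open>a t\<close> alone. It is also the form in which the kernel comes out of the double integral.\<close>

lemma log_kernel_eq:
  assumes "a > 0" "t > 0"
  shows "log_kernel a t = a * (- ln t) * (ln (a * t) / ((a * t)\<^sup>2 - 1))"
proof -
  have "log_kernel a t = a * ln t * ln (a * t) / (- ((a * t)\<^sup>2 - 1))"
    using assms by (simp add: log_kernel_def ln_mult power_mult_distrib)
  then show ?thesis
    by (simp only: divide_minus_right) simp
qed

lemma log_kernel_nonneg:
  assumes "a > 0" "0 \<le> t" "t \<le> 1"
  shows "log_kernel a t \<ge> 0"
proof (cases "t = 0")
  case False
  with assms have "t > 0" by simp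
  then have "0 \<le> a * (- ln t)" "0 \<le> ln (a * t) / ((a * t)\<^sup>2 - 1)"
    using assms by (auto intro!: ln_over_sq_minus_1_nonneg mult_nonneg_nonpos2 simp: mult_nonneg_nonpos)
  then show ?thesis
    using \<open>t > 0\<close> assms by (simp only: log_kernel_eq mult_nonneg_nonneg)
qed (simp add: log_kernel_def)

text \<open>These limits make the antiderivatives in the next two lemmas continuous at \<open>0\<close>.\<close>

lemma tendsto_power_mult_ln_0:
  "((\<lambda>t::real. t ^ Suc n * ln t ^ 2) \<longlongrightarrow> 0) (at_right 0)" "((\<lambda>t::real. t ^ Suc n * ln t) \<longlongrightarrow> 0) (at_right 0)"
proof -
  have p: "((\<lambda>t::real. t ^ n) \<longlongrightarrow> 0 ^ n) (at_right 0)"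
    by (intro tendsto_intros)
  have "((\<lambda>t::real. t * ln t ^ 2) \<longlongrightarrow> 0) (at_right 0)" "((\<lambda>t::real. t * ln t) \<longlongrightarrow> 0) (at_right 0)"
    by real_asymp+
  from tendsto_mult [OF p this(1)] tendsto_mult [OF p this(2)]
  show "((\<lambda>t::real. t ^ Suc n * ln t ^ 2) \<longlongrightarrow> 0) (at_right 0)" "((\<lambda>t::real. t ^ Suc n * ln t) \<longlongrightarrow> 0) (at_right 0)"
    by (simp_all add: mult_ac)
qed

lemma has_integral_power_mult_ln:
  "((\<lambda>t::real. t ^ n * ln t) has_integral (- 1 / real (Suc n) ^ 2)) {0..1}"
proof -
  define m where "m = real (Suc n)"
  have m: "m > 0" by (simp add: m_def)
  define F where "F = (\<lambda>t::real. t ^ Suc n * ln t / m - t ^ Suc n / m\<^sup>2)"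
  have "((\<lambda>t. t ^ n * ln t) has_integral F 1 - F 0) {0..1}"
  proof (rule fundamental_theorem_of_calculus_interior)
    show "continuous_on {0..1} F"
    proof (rule continuous_on_IccI)
      have "(F \<longlongrightarrow> 0 / m - 0 ^ Suc n / m\<^sup>2) (at_right 0)"
        unfolding F_def using m by (intro tendsto_intros tendsto_power_mult_ln_0) auto
      then show "(F \<longlongrightarrow> F 0) (at_right 0)" by (simp add: F_def)
      have F: "F \<midarrow>t\<rightarrow> F t" if "t > 0" for t
        unfolding F_def using that m by (intro tendsto_intros) auto
      show "(F \<longlongrightarrow> F 1) (at_left 1)"
        by (rule tendsto_within_subset [OF F]) auto
      show "F \<midarrow>t\<rightarrow> F t" if "0 < t" for t using F that by auto
    qed auto
    fix t :: real assume "t \<in> {0<..<1}"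
    then have t: "t > 0" by simp
    have d1: "((\<lambda>t. t ^ Suc n) has_real_derivative m * t ^ n) (at t)"
      using DERIV_pow [of "Suc n" t] by (simp add: m_def)
    have d2: "(ln has_real_derivative 1 / t) (at t)"
      by (rule DERIV_ln_divide [OF t])
    have "(F has_real_derivative (m * t ^ n * ln t + 1 / t * t ^ Suc n) / m - m * t ^ n / m\<^sup>2) (at t)"
      unfolding F_def by (intro DERIV_diff DERIV_cdivide DERIV_mult d1 d2)
    also have "(m * t ^ n * ln t + 1 / t * t ^ Suc n) / m - m * t ^ n / m\<^sup>2 = t ^ n * ln t"
      using t m by (simp add: field_simps power2_eq_square)
    finally show "(F has_vector_derivative t ^ n * ln t) (at t)"
      by (simp add: has_real_derivative_iff_has_vector_derivative)
  qed simp
  also have "F 1 - F 0 = - 1 / m\<^sup>2"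
    by (simp add: F_def)
  finally show ?thesis by (simp add: m_def)
qed

lemma has_integral_power_mult_ln_sq:
  "((\<lambda>t::real. t ^ n * ln t ^ 2) has_integral (2 / real (Suc n) ^ 3)) {0..1}"
proof -
  define m where "m = real (Suc n)"
  have m: "m > 0" by (simp add: m_def)
  define F where "F = (\<lambda>t::real. t ^ Suc n * ln t ^ 2 / m)"
  have "((\<lambda>t. t ^ n * ln t ^ 2 + 2 / m * (t ^ n * ln t)) has_integral F 1 - F 0) {0..1}"
  proof (rule fundamental_theorem_of_calculus_interior)
    show "continuous_on {0..1} F"
    proof (rule continuous_on_IccI)
      have "(F \<longlongrightarrow> 0 / m) (at_right 0)"
        unfolding F_def using m by (intro tendsto_divide tendsto_const tendsto_power_mult_ln_0) auto
      then show "(F \<longlongrightarrow> F 0) (at_right 0)" by (simp add: F_def)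
      have F: "F \<midarrow>t\<rightarrow> F t" if "t > 0" for t
        unfolding F_def using that m by (intro tendsto_intros) auto
      show "(F \<longlongrightarrow> F 1) (at_left 1)"
        by (rule tendsto_within_subset [OF F]) auto
      show "F \<midarrow>t\<rightarrow> F t" if "0 < t" for t using F that by auto
    qed auto
    fix t :: real assume "t \<in> {0<..<1}"
    then have t: "t > 0" by simp
    have d1: "((\<lambda>t. t ^ Suc n) has_real_derivative m * t ^ n) (at t)"
      using DERIV_pow [of "Suc n" t] by (simp add: m_def)
    have d2: "((\<lambda>t. ln t ^ 2) has_real_derivative 2 * ln t / t) (at t)"
      using t by (auto intro!: derivative_eq_intros)
    have "(F has_real_derivative (m * t ^ n * ln t ^ 2 + 2 * ln t / t * t ^ Suc n) / m) (at t)"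
      unfolding F_def by (intro DERIV_cdivide DERIV_mult d1 d2)
    also have "(m * t ^ n * ln t ^ 2 + 2 * ln t / t * t ^ Suc n) / m = t ^ n * ln t ^ 2 + 2 / m * (t ^ n * ln t)"
      using t m by (simp add: field_simps)
    finally show "(F has_vector_derivative t ^ n * ln t ^ 2 + 2 / m * (t ^ n * ln t)) (at t)"
      by (simp add: has_real_derivative_iff_has_vector_derivative)
  qed simp
  also have "F 1 - F 0 = 0"
    by (simp add: F_def)
  finally have "((\<lambda>t. (t ^ n * ln t ^ 2 + 2 / m * (t ^ n * ln t)) - 2 / m * (t ^ n * ln t))
      has_integral 0 - 2 / m * (- 1 / m\<^sup>2)) {0..1}"
    unfolding m_def by (intro has_integral_diff has_integral_mult_right has_integral_power_mult_ln)
  then show ?thesis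
    by (simp add: m_def power2_eq_square power3_eq_cube mult.assoc)
qed

text \<open>The factor \<open>1 - s\<close> on the right cancels the zero of a denominator at \<open>s = 1\<close>, at the price of one
more logarithm, which is integrable at \<open>0\<close>.\<close>

lemma minus_ln_le:
  fixes s :: real
  assumes "s > 0"
  shows "- ln s \<le> (1 - s) * (1 - ln s)"
proof -
  have "- ln s = ln (1 / s)" using assms by (simp add: ln_div)
  also have "\<dots> \<le> 1 / s - 1" using assms by (intro ln_le_minus_one) simp
  finally have "s * (- ln s) \<le> s * (1 / s - 1)"
    using assms by (intro mult_left_mono) auto
  then show ?thesis using assms by (simp add: algebra_simps)
qed

lemma ln_over_sq_minus_1_le:
  fixes s :: real
  assumes s: "s > 0"
  shows "ln s / (s\<^sup>2 - 1) \<le> 1 + \<bar>ln s\<bar>"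
proof -
  have f: "s\<^sup>2 - 1 = (s - 1) * (s + 1)"
    by (simp add: power2_eq_square algebra_simps)
  consider "s = 1" | "s > 1" | "s < 1" by linarith
  then show ?thesis
  proof cases
    case 2
    have "ln s / (s\<^sup>2 - 1) \<le> (s - 1) / (s\<^sup>2 - 1)"
      using 2 ln_le_minus_one [OF s] by (intro divide_right_mono) (auto simp: one_le_power)
    also have "\<dots> = 1 / (s + 1)" using 2 by (simp add: f)
    also have "\<dots> \<le> 1" using s by simp
    finally show ?thesis by linarith
  next
    case 3
    have "ln s / (s\<^sup>2 - 1) = (- ln s) / ((1 - s) * (s + 1))"
      unfolding f by (metis minus_diff_eq minus_divide_divide mult_minus_left)
    also have "\<dots> \<le> (- ln s) / (1 - s)"
      using 3 s by (intro divide_left_mono) auto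
    also have "\<dots> \<le> 1 - ln s"
      using 3 minus_ln_le [OF s] by (subst pos_divide_le_eq) (simp_all add: mult.commute)
    finally show ?thesis using 3 s by simp
  qed auto
qed

lemma integrable_ln_polynomial:
  "(\<lambda>t::real. A + B * ln t + C * ln t ^ 2) integrable_on {0..1}"
proof -
  have "(\<lambda>t::real. ln t) integrable_on {0..1}" "(\<lambda>t::real. ln t ^ 2) integrable_on {0..1}"
    using has_integral_power_mult_ln [of 0] has_integral_power_mult_ln_sq [of 0] by auto
  then show ?thesis
    by (intro integrable_add integrable_on_mult_right integrable_const_ivl)
qed

text \<open>By \<open>ln_over_sq_minus_1_le\<close> the pole at \<open>1/a\<close> leaves no trace, and the kernel is dominated by a
quadratic polynomial in \<open>ln t\<close>.\<close>

lemma log_kernel_integrable: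
  assumes a: "a > 0"
  shows "log_kernel a integrable_on {0..1}"
proof (rule measurable_bounded_by_integrable_imp_integrable)
  have "log_kernel a \<in> borel_measurable borel"
    unfolding log_kernel_def by measurable
  then show "log_kernel a \<in> borel_measurable (lebesgue_on {0..1})"
    by (intro measurable_restrict_space1 measurable_completion) simp
  define b where "b = 1 + \<bar>ln a\<bar>"
  show "(\<lambda>t. 0 + (- a * b) * ln t + a * ln t ^ 2) integrable_on {0..1}"
    by (rule integrable_ln_polynomial)
  fix t :: real assume t: "t \<in> {0..1}"
  show "norm (log_kernel a t) \<le> 0 + (- a * b) * ln t + a * ln t ^ 2"
  proof (cases "t = 0")
    case True
    then show ?thesis by (simp add: log_kernel_def)
  next
    case False
    with t have t0: "t > 0" by simp
    then have lt: "ln t \<le> 0" using t by simp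
    have "norm (log_kernel a t) = log_kernel a t"
      using log_kernel_nonneg [OF a] t by simp
    also have "\<dots> = a * (- ln t) * (ln (a * t) / ((a * t)\<^sup>2 - 1))"
      by (rule log_kernel_eq [OF a t0])
    also have "\<dots> \<le> a * (- ln t) * (1 + \<bar>ln (a * t)\<bar>)"
      using a lt t0 by (intro mult_left_mono ln_over_sq_minus_1_le) (auto simp: mult_nonneg_nonpos)
    also have "\<dots> \<le> a * (- ln t) * (b - ln t)"
    proof (rule mult_left_mono)
      have "ln (a * t) = ln a + ln t" using a t0 by (simp add: ln_mult)
      then show "1 + \<bar>ln (a * t)\<bar> \<le> b - ln t" using lt unfolding b_def by linarith
      show "0 \<le> a * (- ln t)" using a lt by (simp add: mult_nonneg_nonpos)
    qed
    finally show ?thesis by (simp add: power2_eq_square algebra_simps)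
  qed
qed simp

section \<open>The mean of the logarithm of a linear polynomial on the unit circle\<close>

text \<open>The mean value property at \<open>0\<close> for the function \<open>Ln (1 - c z)\<close>, which is holomorphic on the closed disc
because \<open>1 - c z\<close> stays in the right half-plane.\<close>

lemma ln_norm_circle_inside:
  fixes c :: complex
  assumes "norm c < 1"
  shows "((\<lambda>t. ln (norm (1 - c * cis t))) has_integral 0) {0..2*pi}"
proof -
  have nz: "1 - c * z \<notin> \<real>\<^sub>\<le>\<^sub>0" if "norm z \<le> 1" for z
  proof -
    have "norm (c * z) < 1"
      using assms that by (metis mult_left_le norm_ge_zero norm_mult order_le_less_trans)
    then have "Re (c * z) < 1"
      using complex_Re_le_cmod [of "c * z"] by linarith
    then show ?thesis
      by (auto simp: complex_nonpos_Reals_iff)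
  qed
  have "(\<lambda>z. Ln (1 - c * z)) holomorphic_on cball 0 1"
    using nz by (intro holomorphic_intros) auto
  from Cauchy_integral_circlepath_simple [OF this, of 0]
  have "((\<lambda>u. Ln (1 - c * u) / u) has_contour_integral 0) (part_circlepath 0 1 0 (2*pi))"
    by (simp add: circlepath_def)
  then have "((\<lambda>t. Ln (1 - c * cis t) * \<i>) has_integral 0) {0..2*pi}"
    by (subst (asm) has_contour_integral_part_circlepath_iff) simp_all
  from has_integral_linear [OF this bounded_linear_Im]
  have "((\<lambda>t. Re (Ln (1 - c * cis t))) has_integral 0) {0..2*pi}"
    by (simp add: o_def)
  moreover have "Re (Ln (1 - c * cis t)) = ln (norm (1 - c * cis t))" for t
    using nz [of "cis t"] by (intro Re_Ln) auto
  ultimately show ?thesis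
    by simp
qed

lemma norm_one_minus_mult_cis_sq:
  "(norm (1 - of_real r * c * cis t))\<^sup>2 = 1 + r\<^sup>2 * (norm c)\<^sup>2 - 2 * r * Re (c * cis t)"
proof -
  define z where "z = c * cis t"
  have "norm z = norm c"
    by (simp add: z_def norm_mult)
  moreover have "(norm (1 - of_real r * z))\<^sup>2 = 1 + r\<^sup>2 * (norm z)\<^sup>2 - 2 * r * Re z"
    unfolding cmod_power2 by (simp add: power2_eq_square algebra_simps)
  ultimately show ?thesis
    by (simp add: z_def mult.assoc)
qed

lemma finite_cis_eq: "finite {t \<in> {0..2*pi}. cis t = u}"
proof -
  have "inj_on cis {0..<2*pi}"
  proof (rule inj_onI)
    fix s t assume st: "s \<in> {0..<2*pi}" "t \<in> {0..<2*pi}" "cis s = cis t"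
    then show "s = t"
      by (metis atLeastLessThan_iff cis_conv_exp Arg2pi_unique zero_less_one mult_1 of_real_1)
  qed
  then have "finite (cis -` {u} \<inter> {0..<2*pi})"
    by (intro finite_vimage_IntI) auto
  then have "finite (insert (2*pi) (cis -` {u} \<inter> {0..<2*pi}))"
    by simp
  then show ?thesis
    by (rule rev_finite_subset) auto
qed

text \<open>The integrand has a logarithmic singularity, so it is approached from the radii \<open>r < 1\<close>. The quotient
\<open>|1 - r c cis t|\<^sup>2 / r = r + 1/r - 2 Re (c cis t)\<close> is used instead of \<open>|1 - r c cis t|\<close> because it
decreases as \<open>r\<close> increases to \<open>1\<close>: monotone convergence then gives both integrability and the value, from
the integrals \<open>- 2 pi ln r\<close>, which tend to \<open>0\<close>.\<close>

lemma ln_norm_circle_on: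
  fixes c :: complex
  assumes c: "norm c = 1"
  shows "((\<lambda>t. ln (norm (1 - c * cis t))) has_integral 0) {0..2*pi}"
proof -
  (* The zeros of 1 - c * cis t, where the decreasing sequence has no finite limit. *)
  define N where "N = {t \<in> {0..2*pi}. cis t = inverse c}"
  have negN: "negligible N"
    unfolding N_def by (intro negligible_finite finite_cis_eq)
  have spike: "(f has_integral y) ({0..2*pi} - N) \<longleftrightarrow> (f has_integral y) {0..2*pi}" for f :: "real \<Rightarrow> real" and y
    by (rule has_integral_spike_set_eq) (auto intro: negligible_subset [OF negN])
  have Re1: "Re (c * cis t) < 1" if "t \<in> {0..2*pi} - N" for t
  proof -
    have "c * cis t \<noteq> 1"
      using that c by (auto simp: N_def field_simps) (metis divide_inverse inverse_unique mult.commute mult_1 norm_zero zero_neq_one)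
    moreover have "norm (c * cis t) = 1"
      using c by (simp add: norm_mult)
    ultimately show ?thesis
      using complex_Re_le_cmod [of "c * cis t"]
      by (metis cmod_power2 complex_eqI less_eq_real_def mult_cancel_left2 one_complex.simps
          power2_eq_square power_zero_numeral add_cancel_right_right zero_eq_power2)
  qed
  define r where "r = (\<lambda>n::nat. 1 - 1 / (real n + 2))"
  have r: "0 < r n" "r n < 1" "r n \<le> r (Suc n)" for n
    by (auto simp: r_def field_simps)
  have rlim: "r \<longlonglongrightarrow> 1"
    unfolding r_def by real_asymp
  have H: "((\<lambda>t. ln (r n + 1 / r n - 2 * Re (c * cis t))) has_integral (- 2 * pi * ln (r n))) ({0..2*pi} - N)" for n
  proof -
    have *: "((\<lambda>t. 2 * ln (norm (1 - (of_real (r n) * c) * cis t)) - ln (r n)) has_integral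
             2 * 0 - ln (r n) * (2 * pi)) {0..2*pi}"
      using r [of n] c has_integral_const_real [of "ln (r n)" 0 "2*pi"]
      by (intro has_integral_diff has_integral_mult_right ln_norm_circle_inside)
         (auto simp: norm_mult mult_ac)
    have eq: "2 * ln (norm (1 - (of_real (r n) * c) * cis t)) - ln (r n)
        = ln (r n + 1 / r n - 2 * Re (c * cis t))" for t
    proof -
      let ?q = "norm (1 - of_real (r n) * c * cis t)"
      have "norm (of_real (r n) * c * cis t) < 1"
        using r [of n] c by (simp add: norm_mult)
      then have q: "?q > 0"
        by (metis diff_eq_diff_eq diff_self norm_one order_less_irrefl zero_less_norm_iff right_minus_eq)
      have "2 * ln ?q - ln (r n) = ln (?q\<^sup>2 / r n)"
        using q r [of n] by (simp add: ln_div ln_realpow)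
      also have "?q\<^sup>2 / r n = r n + 1 / r n - 2 * Re (c * cis t)"
        unfolding norm_one_minus_mult_cis_sq using r(1) [of n] c
        by (simp add: field_simps power2_eq_square)
      finally show ?thesis .
    qed
    have "((\<lambda>t. ln (r n + 1 / r n - 2 * Re (c * cis t))) has_integral (- 2 * pi * ln (r n))) {0..2*pi}"
      using * unfolding eq by (simp add: mult_ac)
    then show ?thesis
      by (simp only: spike)
  qed
  have I: "integral ({0..2*pi} - N) (\<lambda>t. ln (r n + 1 / r n - 2 * Re (c * cis t))) = - 2 * pi * ln (r n)" for n
    using H by (rule integral_unique)
  have rr: "r n + 1 / r n \<ge> 2" for n
  proof -
    have "(r n - 1)\<^sup>2 \<ge> 0" by simp
    then show ?thesis using r(1) [of n] by (simp add: field_simps power2_eq_square)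
  qed
  have rdec: "r (Suc n) + 1 / r (Suc n) \<le> r n + 1 / r n" for n
  proof -
    have "(r n + 1 / r n) - (r (Suc n) + 1 / r (Suc n)) = (r (Suc n) - r n) * (1 - r n * r (Suc n)) / (r n * r (Suc n))"
      using r(1) [of n] r(1) [of "Suc n"] by (simp add: field_simps)
    also have "\<dots> \<ge> 0"
      using r [of n] r [of "Suc n"]
      by (intro divide_nonneg_nonneg mult_nonneg_nonneg) (auto simp: mult_le_one)
    finally show ?thesis by simp
  qed
  have "(\<lambda>t. ln (2 - 2 * Re (c * cis t))) integrable_on ({0..2*pi} - N) \<and>
    (\<lambda>n. integral ({0..2*pi} - N) (\<lambda>t. ln (r n + 1 / r n - 2 * Re (c * cis t)))) \<longlonglongrightarrow>
      integral ({0..2*pi} - N) (\<lambda>t. ln (2 - 2 * Re (c * cis t)))"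
  proof (rule monotone_convergence_decreasing)
    show "(\<lambda>t. ln (r n + 1 / r n - 2 * Re (c * cis t))) integrable_on ({0..2*pi} - N)" for n
      using H by blast
    show "ln (r (Suc n) + 1 / r (Suc n) - 2 * Re (c * cis t)) \<le> ln (r n + 1 / r n - 2 * Re (c * cis t))"
      if "t \<in> {0..2*pi} - N" for n t
      using Re1 [OF that] rr [of "Suc n"] rdec [of n] by (subst ln_le_cancel_iff) auto
    show "(\<lambda>n. ln (r n + 1 / r n - 2 * Re (c * cis t))) \<longlonglongrightarrow> ln (2 - 2 * Re (c * cis t))"
      if "t \<in> {0..2*pi} - N" for t
    proof -
      have "(\<lambda>n. r n + 1 / r n - 2 * Re (c * cis t)) \<longlonglongrightarrow> 1 + 1 / 1 - 2 * Re (c * cis t)"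
        by (intro tendsto_intros rlim) auto
      then show ?thesis
        using Re1 [OF that] by (intro tendsto_ln) auto
    qed
    show "bounded (range (\<lambda>n. integral ({0..2*pi} - N) (\<lambda>t. ln (r n + 1 / r n - 2 * Re (c * cis t)))))"
    proof -
      have "(\<lambda>n. - 2 * pi * ln (r n)) \<longlonglongrightarrow> - 2 * pi * ln 1"
        by (intro tendsto_intros rlim) auto
      then show ?thesis
        unfolding I by (intro convergent_imp_bounded) 
    qed
  qed
  moreover have "(\<lambda>n. - 2 * pi * ln (r n)) \<longlonglongrightarrow> - 2 * pi * ln 1"
    by (intro tendsto_intros rlim) auto
  ultimately have "((\<lambda>t. ln (2 - 2 * Re (c * cis t))) has_integral 0) ({0..2*pi} - N)"
    unfolding I by (metis (no_types, lifting) LIMSEQ_unique has_integral_integrable_integral ln_one mult_zero_right)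
  then have "((\<lambda>t. ln (2 - 2 * Re (c * cis t)) / 2) has_integral 0 / 2) ({0..2*pi} - N)"
    by (rule has_integral_divide)
  moreover have "ln (2 - 2 * Re (c * cis t)) / 2 = ln (norm (1 - c * cis t))" if "t \<in> {0..2*pi} - N" for t
  proof -
    have sq: "(norm (1 - c * cis t))\<^sup>2 = 2 - 2 * Re (c * cis t)"
      using norm_one_minus_mult_cis_sq [of 1 c t] c by simp
    then have "norm (1 - c * cis t) > 0"
      using Re1 [OF that] by (metis diff_gt_0_iff_gt less_irrefl mult_2_right one_add_one zero_less_norm_iff norm_zero zero_power2 mult.right_neutral mult_less_cancel_left_pos zero_less_numeral)
    then have "ln ((norm (1 - c * cis t))\<^sup>2) = 2 * ln (norm (1 - c * cis t))"
      by (simp add: ln_realpow)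
    then show ?thesis
      unfolding sq by linarith
  qed
  ultimately have "((\<lambda>t. ln (norm (1 - c * cis t))) has_integral 0) ({0..2*pi} - N)"
    by (subst has_integral_cong [symmetric]) auto
  then show ?thesis
    by (simp only: spike)
qed

text \<open>Jensen's formula for a linear polynomial. For \<open>|c| > 1\<close> the circle identity
\<open>|1 - c z| = |c| |1 - z / cnj c|\<close> (valid when \<open>|z| = 1\<close>) reflects the zero to the outside of the circle.\<close>

lemma ln_norm_circle:
  fixes c :: complex
  shows "((\<lambda>t. ln (norm (1 - c * cis t))) has_integral 2 * pi * ln (max 1 (norm c))) {0..2*pi}"
proof (cases "norm c \<le> 1")
  case True
  then show ?thesis
    using ln_norm_circle_inside ln_norm_circle_on by (cases "norm c = 1") auto
next
  case False
  then have c: "norm c > 1" by simp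
  have "norm (inverse (cnj c)) < 1"
    using c by (simp add: norm_inverse inverse_less_1_iff)
  from has_integral_add [OF ln_norm_circle_inside [OF this] has_integral_const_real [of "ln (norm c)" 0 "2 * pi"]]
  have "((\<lambda>t. ln (norm (1 - inverse (cnj c) * cis t)) + ln (norm c)) has_integral 2 * pi * ln (norm c)) {0..2*pi}"
    by simp
  moreover have "ln (norm (1 - inverse (cnj c) * cis t)) + ln (norm c) = ln (norm (1 - c * cis t))" for t
  proof -
    have "1 - c * cis t = - (c * cis t) * cnj (1 - inverse (cnj c) * cis t)"
    proof -
      have "c \<noteq> 0" "cis t * cis (- t) = 1"
        using c by (auto simp: cis_mult)
      then show ?thesis
        by (simp add: field_simps cis_cnj)
    qed
    then have "norm (1 - c * cis t) = norm c * norm (1 - inverse (cnj c) * cis t)"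
      by (simp add: norm_mult del: complex_cnj_diff complex_cnj_mult)
    moreover have "1 - inverse (cnj c) * cis t \<noteq> 0"
    proof
      assume "1 - inverse (cnj c) * cis t = 0"
      then have "norm (inverse (cnj c) * cis t) = 1" by (metis norm_one right_minus_eq)
      then show False using c by (simp add: norm_mult norm_inverse)
    qed
    ultimately show ?thesis
      using c by (simp add: ln_mult)
  qed
  ultimately show ?thesis
    using c by simp
qed

text \<open>The factorization \<open>A (1 - c cis t)\<close> turns into a sum of logarithms except where the polynomial vanishes,
because there the convention \<open>ln 0 = 0\<close> breaks the product rule.\<close>

lemma ln_norm_circle_linear:
  fixes A B :: complex
  assumes A: "A \<noteq> 0"
  shows "((\<lambda>t. ln (norm (A + B * cis t))) has_integral 2 * pi * ln (max (norm A) (norm B))) {0..2*pi}"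
proof -
  define c where "c = - B / A"
  have "((\<lambda>t. ln (norm A) + ln (norm (1 - c * cis t))) has_integral
      2 * pi * ln (norm A) + 2 * pi * ln (max 1 (norm c))) {0..2*pi}"
    using has_integral_const_real [of "ln (norm A)" 0 "2*pi"]
    by (intro has_integral_add ln_norm_circle) simp
  also have "2 * pi * ln (norm A) + 2 * pi * ln (max 1 (norm c)) = 2 * pi * ln (norm A * max 1 (norm c))"
    using A by (subst ln_mult) (auto simp: distrib_left)
  also have "norm A * max 1 (norm c) = max (norm A) (norm B)"
    using A by (auto simp: c_def norm_divide max_def field_simps)
  finally have I: "((\<lambda>t. ln (norm A) + ln (norm (1 - c * cis t))) has_integral
      2 * pi * ln (max (norm A) (norm B))) {0..2*pi}" .
  show ?thesis
  proof (rule has_integral_spike_finite [OF finite_cis_eq [of "inverse c"] _ I])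
    fix t assume t: "t \<in> {0..2*pi} - {t \<in> {0..2*pi}. cis t = inverse c}"
    have "c * cis t \<noteq> 1"
    proof
      assume *: "c * cis t = 1"
      then have "cis t = inverse c" by (metis inverse_unique)
      with t show False by auto
    qed
    moreover have "A + B * cis t = A * (1 - c * cis t)"
      using A by (simp add: c_def algebra_simps)
    ultimately show "ln (norm (A + B * cis t)) = ln (norm A) + ln (norm (1 - c * cis t))"
      using A by (simp add: norm_mult ln_mult)
  qed
qed

lemma norm_one_plus_cis: "norm (1 + cis t) = 2 * \<bar>cos (t / 2)\<bar>"
proof -
  have "(norm (1 + cis t))\<^sup>2 = 2 + 2 * cos t"
    unfolding cmod_power2 using sin_cos_squared_add [of t] by (simp add: power2_eq_square algebra_simps)
  also have "\<dots> = (2 * \<bar>cos (t / 2)\<bar>)\<^sup>2"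
    using cos_double_cos [of "t / 2"] by (simp add: power_mult_distrib)
  finally show ?thesis
    by (rule power2_eq_imp_eq) auto
qed

lemma norm_one_minus_cis: "norm (1 - cis t) = 2 * \<bar>sin (t / 2)\<bar>"
proof -
  have "(norm (1 - cis t))\<^sup>2 = 2 - 2 * cos t"
    unfolding cmod_power2 using sin_cos_squared_add [of t] by (simp add: power2_eq_square algebra_simps)
  also have "\<dots> = (2 * \<bar>sin (t / 2)\<bar>)\<^sup>2"
    using cos_double_sin [of "t / 2"] by (simp add: power_mult_distrib)
  finally show ?thesis
    by (rule power2_eq_imp_eq) auto
qed

section \<open>The double integral of the positive part of the logarithm\<close>

lemma nn_integral_even:
  fixes h :: "real \<Rightarrow> ennreal"
  assumes [measurable]: "h \<in> borel_measurable borel" and even: "\<And>x. h (- x) = h x"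
  shows "(\<integral>\<^sup>+x. h x \<partial>lborel) = 2 * (\<integral>\<^sup>+x. h x * indicator {0<..} x \<partial>lborel)"
proof -
  have "(\<integral>\<^sup>+x. h x \<partial>lborel) = (\<integral>\<^sup>+x. h x * indicator {0<..} x + h x * indicator {..<0} x \<partial>lborel)"
    by (rule nn_integral_cong_AE, rule AE_mp [OF AE_lborel_singleton [of 0]])
       (auto split: split_indicator)
  also have "\<dots> = (\<integral>\<^sup>+x. h x * indicator {0<..} x \<partial>lborel) + (\<integral>\<^sup>+x. h x * indicator {..<0} x \<partial>lborel)"
    by (rule nn_integral_add) auto
  also have "(\<integral>\<^sup>+x. h x * indicator {..<0} x \<partial>lborel) = (\<integral>\<^sup>+x. h x * indicator {0<..} x \<partial>lborel)"
    by (subst nn_integral_real_affine [where c = "-1" and t = 0])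
       (auto simp: even intro!: nn_integral_cong split: split_indicator)
  finally show ?thesis
    by (simp add: mult_2)
qed

text \<open>The substitution rule on compact intervals, exhausted from inside.\<close>

lemma nn_integral_arctan_substitution:
  fixes f :: "real \<Rightarrow> ennreal"
  assumes [measurable]: "f \<in> borel_measurable borel"
  shows "(\<integral>\<^sup>+x. f x * indicator {0<..<pi/2} x \<partial>lborel)
       = (\<integral>\<^sup>+u. f (arctan u) * ennreal (1 / (1 + u\<^sup>2)) * indicator {0<..} u \<partial>lborel)"
proof -
  have fin: "(\<integral>\<^sup>+x. f x * indicator {0..arctan (real n + 1)} x \<partial>lborel)
       = (\<integral>\<^sup>+u. f (arctan u) * ennreal (1 / (1 + u\<^sup>2)) * indicator {0..real n + 1} u \<partial>lborel)" for n
  proof -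
    have "(arctan has_real_derivative 1 / (1 + x\<^sup>2)) (at x)" for x
      by (auto intro!: derivative_eq_intros simp: inverse_eq_divide)
    moreover have "1 + x\<^sup>2 \<noteq> 0" for x :: real
      by (simp add: add_nonneg_eq_0_iff)
    then have "continuous_on {0..real n + 1} (\<lambda>u. 1 / (1 + u\<^sup>2))"
      by (intro continuous_intros) auto
    ultimately show ?thesis
      using nn_integral_substitution_aux [of f 0 "real n + 1" arctan "\<lambda>u. 1 / (1 + u\<^sup>2)"]
      by simp
  qed
  have [measurable]: "arctan \<in> borel_measurable borel"
    by (intro borel_measurable_continuous_onI continuous_intros)
  have "(\<integral>\<^sup>+x. f x * indicator {0<..<pi/2} x \<partial>lborel)
     = (\<integral>\<^sup>+x. (SUP n. f x * indicator {0..arctan (real n + 1)} x) \<partial>lborel)"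
  proof (rule nn_integral_cong_AE, rule AE_mp [OF AE_lborel_singleton [of 0]], rule AE_I2, rule impI)
    fix x :: real assume "x \<noteq> 0"
    show "f x * indicator {0<..<pi/2} x = (SUP n. f x * indicator {0..arctan (real n + 1)} x)"
    proof (cases "x \<in> {0<..<pi/2}")
      case True
      obtain N where N: "tan x \<le> real N" using real_arch_simple by blast
      have "arctan (tan x) \<le> arctan (real N + 1)"
        using N by (subst arctan_le_iff) auto
      then have "x \<le> arctan (real N + 1)"
        using True by (simp add: arctan_tan)
      then show ?thesis
        using True by (intro antisym SUP_upper2 [of N] SUP_least) (auto split: split_indicator)
    next
      case False
      then have "x \<notin> {0..arctan (real n + 1)}" for n
        using \<open>x \<noteq> 0\<close> arctan_ubound [of "real n + 1"] by auto
      then show ?thesis using False by simp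
    qed
  qed
  also have "\<dots> = (SUP n. \<integral>\<^sup>+x. f x * indicator {0..arctan (real n + 1)} x \<partial>lborel)"
  proof (intro nn_integral_monotone_convergence_SUP)
    have "arctan (real m + 1) \<le> arctan (real n + 1)" if "m \<le> n" for m n
      using that by (subst arctan_le_iff) auto
    then have "{0..arctan (real m + 1)} \<subseteq> {0..arctan (real n + 1)}" if "m \<le> n" for m n
      using that by (meson atLeastatMost_subset_iff order_refl)
    then show "incseq (\<lambda>n x. f x * indicator {0..arctan (real n + 1)} x)"
      unfolding incseq_def le_fun_def
      by (intro allI impI mult_left_mono) (auto split: split_indicator simp: subset_eq)
  qed measurable
  also have "\<dots> = (SUP n. \<integral>\<^sup>+u. f (arctan u) * ennreal (1 / (1 + u\<^sup>2)) * indicator {0..real n + 1} u \<partial>lborel)"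
    by (simp only: fin)
  also have "\<dots> = (\<integral>\<^sup>+u. (SUP n. f (arctan u) * ennreal (1 / (1 + u\<^sup>2)) * indicator {0..real n + 1} u) \<partial>lborel)"
    by (intro nn_integral_monotone_convergence_SUP [symmetric])
       (auto simp: incseq_def le_fun_def intro!: mult_left_mono split: split_indicator)
  also have "\<dots> = (\<integral>\<^sup>+u. f (arctan u) * ennreal (1 / (1 + u\<^sup>2)) * indicator {0<..} u \<partial>lborel)"
  proof (rule nn_integral_cong_AE, rule AE_mp [OF AE_lborel_singleton [of 0]], rule AE_I2, rule impI)
    fix u :: real assume "u \<noteq> 0"
    show "(SUP n. f (arctan u) * ennreal (1 / (1 + u\<^sup>2)) * indicator {0..real n + 1} u)
        = f (arctan u) * ennreal (1 / (1 + u\<^sup>2)) * indicator {0<..} u"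
    proof (cases "u > 0")
      case True
      obtain N where "u \<le> real N" using real_arch_simple by blast
      then show ?thesis
        using True by (intro antisym SUP_upper2 [of N] SUP_least) (auto split: split_indicator)
    next
      case False
      then show ?thesis using \<open>u \<noteq> 0\<close> by simp
    qed
  qed
  finally show ?thesis .
qed

text \<open>The cotangent is used as the new variable: \<open>\<bar>tan (t / 2)\<bar> = 1 / u\<close>. The integrand is even about
\<open>t = pi\<close>, and the shift by \<open>pi\<close> turns the tangent into the cotangent of \<open>x\<close> with \<open>t = pi + 2 x\<close>.\<close>

lemma nn_integral_abs_tan:
  fixes f :: "real \<Rightarrow> ennreal"
  assumes [measurable]: "f \<in> borel_measurable borel"
  shows "(\<integral>\<^sup>+t. f \<bar>tan (t / 2)\<bar> * indicator {0..2*pi} t \<partial>lborel)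
       = 4 * (\<integral>\<^sup>+u. f (1 / u) * ennreal (1 / (1 + u\<^sup>2)) * indicator {0<..} u \<partial>lborel)"
proof -
  have [measurable]: "(tan :: real \<Rightarrow> real) \<in> borel_measurable borel"
    unfolding tan_def by measurable
  have tan_shift: "\<bar>tan (pi / 2 + x)\<bar> = 1 / \<bar>tan x\<bar>" for x :: real
    by (simp add: tan_def sin_add cos_add)
  have "(\<integral>\<^sup>+t. f \<bar>tan (t / 2)\<bar> * indicator {0..2*pi} t \<partial>lborel)
      = 2 * (\<integral>\<^sup>+x. f (1 / \<bar>tan x\<bar>) * indicator {-pi/2..pi/2} x \<partial>lborel)"
    by (subst nn_integral_real_affine [where c = 2 and t = pi])
       (auto simp: tan_shift add_divide_distrib indicator_def intro!: nn_integral_cong arg_cong [where f = "\<lambda>x. 2 * x"])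
  also have "(\<integral>\<^sup>+x. f (1 / \<bar>tan x\<bar>) * indicator {-pi/2..pi/2} x \<partial>lborel)
      = 2 * (\<integral>\<^sup>+x. f (1 / \<bar>tan x\<bar>) * indicator {-pi/2..pi/2} x * indicator {0<..} x \<partial>lborel)"
    by (rule nn_integral_even) (auto simp: indicator_def)
  also have "(\<integral>\<^sup>+x. f (1 / \<bar>tan x\<bar>) * indicator {-pi/2..pi/2} x * indicator {0<..} x \<partial>lborel)
      = (\<integral>\<^sup>+x. f (1 / \<bar>tan x\<bar>) * indicator {0<..<pi/2} x \<partial>lborel)"
    by (rule nn_integral_cong_AE, rule AE_mp [OF AE_lborel_singleton [of "pi/2"]])
       (auto split: split_indicator)
  also have "\<dots> = (\<integral>\<^sup>+u. f (1 / \<bar>tan (arctan u)\<bar>) * ennreal (1 / (1 + u\<^sup>2)) * indicator {0<..} u \<partial>lborel)"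
    by (rule nn_integral_arctan_substitution) measurable
  also have "\<dots> = (\<integral>\<^sup>+u. f (1 / u) * ennreal (1 / (1 + u\<^sup>2)) * indicator {0<..} u \<partial>lborel)"
    by (rule nn_integral_cong) (auto simp: tan_arctan split: split_indicator)
  finally show ?thesis
    by (simp flip: mult.assoc)
qed

text \<open>Partial fractions: \<open>(ln (1 + u\<^sup>2) - ln (u\<^sup>2 + s\<^sup>2)) / (2 (s\<^sup>2 - 1))\<close> is an antiderivative that
vanishes at infinity.\<close>

lemma nn_integral_rational:
  fixes s :: real
  assumes s: "s > 0" "s \<noteq> 1"
  shows "(\<integral>\<^sup>+u. ennreal (u / ((1 + u\<^sup>2) * (u\<^sup>2 + s\<^sup>2))) * indicator {0<..} u \<partial>lborel)
       = ennreal (ln s / (s\<^sup>2 - 1))"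
proof -
  define F where "F = (\<lambda>u. (ln (1 + u\<^sup>2) - ln (u\<^sup>2 + s\<^sup>2)) / (2 * (s\<^sup>2 - 1)))"
  have s2: "s\<^sup>2 \<noteq> 1" "s\<^sup>2 > 0"
    using s by (auto simp: power2_eq_1_iff)
  have "(\<integral>\<^sup>+u. ennreal (u / ((1 + u\<^sup>2) * (u\<^sup>2 + s\<^sup>2))) * indicator {0<..} u \<partial>lborel)
      = (\<integral>\<^sup>+u. ennreal (u / ((1 + u\<^sup>2) * (u\<^sup>2 + s\<^sup>2))) * indicator {0..} u \<partial>lborel)"
    by (rule nn_integral_cong) (auto split: split_indicator)
  also have "\<dots> = ennreal (0 - F 0)"
  proof (rule nn_integral_FTC_atLeast)
    fix u :: real assume "u \<ge> 0"
    have pos: "1 + u\<^sup>2 > 0" "u\<^sup>2 + s\<^sup>2 > 0"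
      using s2 by (auto simp: add_pos_nonneg add_nonneg_pos)
    have "(F has_real_derivative (2 * u / (1 + u\<^sup>2) - 2 * u / (u\<^sup>2 + s\<^sup>2)) / (2 * (s\<^sup>2 - 1))) (at u)"
      unfolding F_def using pos s2 by (auto intro!: derivative_eq_intros)
    also have "(2 * u / (1 + u\<^sup>2) - 2 * u / (u\<^sup>2 + s\<^sup>2)) / (2 * (s\<^sup>2 - 1)) = u / ((1 + u\<^sup>2) * (u\<^sup>2 + s\<^sup>2))"
    proof -
      have "2 * u / (1 + u\<^sup>2) - 2 * u / (u\<^sup>2 + s\<^sup>2) = 2 * u * (s\<^sup>2 - 1) / ((1 + u\<^sup>2) * (u\<^sup>2 + s\<^sup>2))"
        using pos by (subst diff_frac_eq) (auto simp: algebra_simps)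
      moreover have "2 * u * q / D / (2 * q) = u / D" if "q \<noteq> 0" for q D :: real
        using that by simp
      ultimately show ?thesis using s2(1) by (metis right_minus_eq)
    qed
    finally show "(F has_real_derivative u / ((1 + u\<^sup>2) * (u\<^sup>2 + s\<^sup>2))) (at u)" .
    show "0 \<le> u / ((1 + u\<^sup>2) * (u\<^sup>2 + s\<^sup>2))"
      using pos \<open>u \<ge> 0\<close> by (intro divide_nonneg_nonneg mult_nonneg_nonneg) auto
  next
    have "((\<lambda>u::real. ln (1 + u\<^sup>2) - ln (u\<^sup>2 + s\<^sup>2)) \<longlongrightarrow> 0) at_top"
      using s2 by real_asymp
    then have "((\<lambda>u::real. (ln (1 + u\<^sup>2) - ln (u\<^sup>2 + s\<^sup>2)) / (2 * (s\<^sup>2 - 1))) \<longlongrightarrow> 0 / (2 * (s\<^sup>2 - 1))) at_top"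
      by (intro tendsto_divide) (use s2 in auto)
    then show "(F \<longlongrightarrow> 0) at_top"
      by (simp add: F_def)
  qed measurable
  also have "0 - F 0 = ln s / (s\<^sup>2 - 1)"
  proof -
    have "0 - F 0 = (2 * ln s) / (2 * (s\<^sup>2 - 1))"
      using s by (simp add: F_def ln_realpow)
    then show ?thesis
      by (simp only: mult_divide_mult_cancel_left_if) simp
  qed
  finally show ?thesis .
qed

text \<open>The logarithmic factor depends only on the product \<open>u v\<close>, so \<open>v = s / u\<close> separates the variables:
after exchanging the order, the integral over \<open>u\<close> is \<open>nn_integral_rational\<close>, and \<open>s = a t\<close> makes
the range \<open>{0..1}\<close>, since the logarithm is cut off where \<open>s > a\<close>.\<close>

lemma nn_integral_log_plus_plane:
  fixes a :: real
  assumes a: "a > 0"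
  shows "(\<integral>\<^sup>+u. (\<integral>\<^sup>+v. ennreal (ln (max 1 (a * (1 / u) * (1 / v)))) * ennreal (1 / (1 + v\<^sup>2)) * indicator {0<..} v \<partial>lborel)
            * ennreal (1 / (1 + u\<^sup>2)) * indicator {0<..} u \<partial>lborel)
       = (\<integral>\<^sup>+t. ennreal (log_kernel a t) * indicator {0..1} t \<partial>lborel)"
    (is "?L = ?R")
proof -
  define \<phi> where "\<phi> = (\<lambda>s::real. ennreal (ln (max 1 (a / s))))"
  have [measurable]: "\<phi> \<in> borel_measurable borel"
    unfolding \<phi>_def by measurable
  have inner: "(\<integral>\<^sup>+v. ennreal (ln (max 1 (a * (1 / u) * (1 / v)))) * ennreal (1 / (1 + v\<^sup>2)) * indicator {0<..} v \<partial>lborel)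
      = (\<integral>\<^sup>+s. \<phi> s * ennreal (u / (u\<^sup>2 + s\<^sup>2)) * indicator {0<..} s \<partial>lborel)" if u: "u > 0" for u
  proof -
    have "(\<integral>\<^sup>+v. ennreal (ln (max 1 (a * (1 / u) * (1 / v)))) * ennreal (1 / (1 + v\<^sup>2)) * indicator {0<..} v \<partial>lborel)
        = ennreal (1 / u) * (\<integral>\<^sup>+s. \<phi> s * ennreal (1 / (1 + (s / u)\<^sup>2)) * indicator {0<..} s \<partial>lborel)"
      using u by (subst nn_integral_real_affine [where c = "1 / u" and t = 0])
        (auto simp: \<phi>_def zero_less_divide_iff intro!: nn_integral_cong arg_cong [where f = "\<lambda>x. ennreal (1 / u) * x"]
          split: split_indicator)
    also have "\<dots> = (\<integral>\<^sup>+s. ennreal (1 / u) * (\<phi> s * ennreal (1 / (1 + (s / u)\<^sup>2)) * indicator {0<..} s) \<partial>lborel)"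
      by (rule nn_integral_cmult [symmetric]) measurable
    also have "\<dots> = (\<integral>\<^sup>+s. \<phi> s * ennreal (u / (u\<^sup>2 + s\<^sup>2)) * indicator {0<..} s \<partial>lborel)"
    proof (rule nn_integral_cong)
      fix s :: real
      have "ennreal (1 / u) * ennreal (1 / (1 + (s / u)\<^sup>2)) = ennreal ((1 / u) * (1 / (1 + (s / u)\<^sup>2)))"
        using u by (intro ennreal_mult [symmetric]) auto
      also have "(1 / u) * (1 / (1 + (s / u)\<^sup>2)) = u / (u\<^sup>2 + s\<^sup>2)"
        using u by (simp add: power_divide field_simps power2_eq_square)
      finally have *: "ennreal (1 / u) * ennreal (1 / (1 + (s / u)\<^sup>2)) = ennreal (u / (u\<^sup>2 + s\<^sup>2))" .
      show "ennreal (1 / u) * (\<phi> s * ennreal (1 / (1 + (s / u)\<^sup>2)) * indicator {0<..} s)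
          = \<phi> s * ennreal (u / (u\<^sup>2 + s\<^sup>2)) * indicator {0<..} s"
        by (simp only: * [symmetric] mult_ac)
    qed
    finally show ?thesis .
  qed
  have "?L = (\<integral>\<^sup>+u. (\<integral>\<^sup>+s. \<phi> s * ennreal (u / (u\<^sup>2 + s\<^sup>2)) * indicator {0<..} s \<partial>lborel)
            * ennreal (1 / (1 + u\<^sup>2)) * indicator {0<..} u \<partial>lborel)"
    by (rule nn_integral_cong, rename_tac u, case_tac "u > 0") (simp_all only: inner, simp)
  also have "\<dots> = (\<integral>\<^sup>+u. \<integral>\<^sup>+s. (\<phi> s * indicator {0<..} s) *
                 (ennreal (u / ((1 + u\<^sup>2) * (u\<^sup>2 + s\<^sup>2))) * indicator {0<..} u) \<partial>lborel \<partial>lborel)"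
  proof (rule nn_integral_cong)
    fix u :: real
    have e: "ennreal (u / (u\<^sup>2 + s\<^sup>2)) * ennreal (1 / (1 + u\<^sup>2)) = ennreal (u / ((1 + u\<^sup>2) * (u\<^sup>2 + s\<^sup>2)))" if "u > 0" for s
      using that by (subst ennreal_mult' [symmetric]) (auto simp: mult.commute)
    have "(\<integral>\<^sup>+s. \<phi> s * ennreal (u / (u\<^sup>2 + s\<^sup>2)) * indicator {0<..} s \<partial>lborel)
            * ennreal (1 / (1 + u\<^sup>2)) * indicator {0<..} u
      = (\<integral>\<^sup>+s. (\<phi> s * ennreal (u / (u\<^sup>2 + s\<^sup>2)) * indicator {0<..} s)
            * (ennreal (1 / (1 + u\<^sup>2)) * indicator {0<..} u) \<partial>lborel)"
      unfolding mult.assoc [of "integral\<^sup>N _ _"] by (rule nn_integral_multc [symmetric]) measurable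
    also have "\<dots> = (\<integral>\<^sup>+s. (\<phi> s * indicator {0<..} s) *
                 (ennreal (u / ((1 + u\<^sup>2) * (u\<^sup>2 + s\<^sup>2))) * indicator {0<..} u) \<partial>lborel)"
      by (rule nn_integral_cong) (auto simp: e [symmetric] mult_ac split: split_indicator)
    finally show "(\<integral>\<^sup>+s. \<phi> s * ennreal (u / (u\<^sup>2 + s\<^sup>2)) * indicator {0<..} s \<partial>lborel)
            * ennreal (1 / (1 + u\<^sup>2)) * indicator {0<..} u
      = (\<integral>\<^sup>+s. (\<phi> s * indicator {0<..} s) *
                 (ennreal (u / ((1 + u\<^sup>2) * (u\<^sup>2 + s\<^sup>2))) * indicator {0<..} u) \<partial>lborel)" .
  qed
  also have "\<dots> = (\<integral>\<^sup>+s. \<integral>\<^sup>+u. (\<phi> s * indicator {0<..} s) *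
                 (ennreal (u / ((1 + u\<^sup>2) * (u\<^sup>2 + s\<^sup>2))) * indicator {0<..} u) \<partial>lborel \<partial>lborel)"
    by (rule lborel_pair.Fubini') measurable
  also have "\<dots> = (\<integral>\<^sup>+s. \<phi> s * ennreal (ln s / (s\<^sup>2 - 1)) * indicator {0<..} s \<partial>lborel)"
  proof (rule nn_integral_cong_AE, rule AE_mp [OF AE_lborel_singleton [of 1]], rule AE_I2, rule impI)
    fix s :: real assume "s \<noteq> 1"
    have "(\<integral>\<^sup>+u. (\<phi> s * indicator {0<..} s) *
                 (ennreal (u / ((1 + u\<^sup>2) * (u\<^sup>2 + s\<^sup>2))) * indicator {0<..} u) \<partial>lborel)
      = (\<phi> s * indicator {0<..} s) * (\<integral>\<^sup>+u. (ennreal (u / ((1 + u\<^sup>2) * (u\<^sup>2 + s\<^sup>2))) * indicator {0<..} u) \<partial>lborel)"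
      by (rule nn_integral_cmult) measurable
    also have "\<dots> = \<phi> s * ennreal (ln s / (s\<^sup>2 - 1)) * indicator {0<..} s"
      using nn_integral_rational [OF _ \<open>s \<noteq> 1\<close>] by (auto split: split_indicator)
    finally show "(\<integral>\<^sup>+u. (\<phi> s * indicator {0<..} s) *
                 (ennreal (u / ((1 + u\<^sup>2) * (u\<^sup>2 + s\<^sup>2))) * indicator {0<..} u) \<partial>lborel)
       = \<phi> s * ennreal (ln s / (s\<^sup>2 - 1)) * indicator {0<..} s" .
  qed
  also have "\<dots> = ennreal a * (\<integral>\<^sup>+t. \<phi> (a * t) * ennreal (ln (a * t) / ((a * t)\<^sup>2 - 1)) * indicator {0<..} (a * t) \<partial>lborel)"
    using a by (subst nn_integral_real_affine [where c = a and t = 0]) auto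
  also have "\<dots> = (\<integral>\<^sup>+t. ennreal a * (\<phi> (a * t) * ennreal (ln (a * t) / ((a * t)\<^sup>2 - 1)) * indicator {0<..} (a * t)) \<partial>lborel)"
    by (rule nn_integral_cmult [symmetric]) measurable
  also have "\<dots> = ?R"
  proof (rule nn_integral_cong_AE, rule AE_mp [OF AE_lborel_singleton [of 0]], rule AE_I2, rule impI)
    fix t :: real assume "t \<noteq> 0"
    consider "t < 0" | "t > 1" | "0 < t" "t \<le> 1" using \<open>t \<noteq> 0\<close> by linarith
    then show "ennreal a * (\<phi> (a * t) * ennreal (ln (a * t) / ((a * t)\<^sup>2 - 1)) * indicator {0<..} (a * t))
        = ennreal (log_kernel a t) * indicator {0..1} t"
    proof cases
      case 1
      then have "\<not> a * t > 0" using a by (simp add: zero_less_mult_iff)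
      then show ?thesis using 1 by simp
    next
      case 2
      then have "max 1 (a / (a * t)) = 1" using a by (simp add: field_simps max_def)
      then show ?thesis using 2 by (simp add: \<phi>_def)
    next
      case 3
      then have "max 1 (a / (a * t)) = 1 / t" using a by (simp add: field_simps max_def)
      then have \<phi>: "\<phi> (a * t) = ennreal (- ln t)" using 3 by (simp add: \<phi>_def ln_div)
      have "0 \<le> a * (- ln t)" "0 \<le> ln (a * t) / ((a * t)\<^sup>2 - 1)"
        using 3 a by (auto intro!: ln_over_sq_minus_1_nonneg simp: mult_nonneg_nonpos)
      then have "ennreal a * ennreal (- ln t) * ennreal (ln (a * t) / ((a * t)\<^sup>2 - 1)) = ennreal (log_kernel a t)"
        using 3 a by (simp only: log_kernel_eq ennreal_mult' ennreal_mult'' less_imp_le)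
      then show ?thesis
        using 3 a by (simp add: \<phi> mult.assoc)
    qed
  qed
  finally show ?thesis .
qed

lemma nn_integral_log_plus_torus:
  fixes a :: real
  assumes a: "a > 0"
  shows "(\<integral>\<^sup>+s. (\<integral>\<^sup>+t. ennreal (ln (max 1 (a * \<bar>tan (s / 2)\<bar> * \<bar>tan (t / 2)\<bar>))) * indicator {0..2*pi} t \<partial>lborel)
            * indicator {0..2*pi} s \<partial>lborel)
       = 16 * (\<integral>\<^sup>+t. ennreal (log_kernel a t) * indicator {0..1} t \<partial>lborel)"
proof -
  define g where "g = (\<lambda>y. \<integral>\<^sup>+v. ennreal (ln (max 1 (a * y * (1 / v)))) * ennreal (1 / (1 + v\<^sup>2)) * indicator {0<..} v \<partial>lborel)"
  have [measurable]: "g \<in> borel_measurable borel"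
    unfolding g_def by measurable
  have "(\<integral>\<^sup>+t. ennreal (ln (max 1 (a * y * \<bar>tan (t / 2)\<bar>))) * indicator {0..2*pi} t \<partial>lborel) = 4 * g y" for y
    unfolding g_def by (rule nn_integral_abs_tan) measurable
  then have "(\<integral>\<^sup>+s. (\<integral>\<^sup>+t. ennreal (ln (max 1 (a * \<bar>tan (s / 2)\<bar> * \<bar>tan (t / 2)\<bar>))) * indicator {0..2*pi} t \<partial>lborel)
            * indicator {0..2*pi} s \<partial>lborel)
       = (\<integral>\<^sup>+s. 4 * g \<bar>tan (s / 2)\<bar> * indicator {0..2*pi} s \<partial>lborel)"
    by simp
  also have "\<dots> = 4 * (\<integral>\<^sup>+u. 4 * g (1 / u) * ennreal (1 / (1 + u\<^sup>2)) * indicator {0<..} u \<partial>lborel)"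
    by (rule nn_integral_abs_tan [of "\<lambda>y. 4 * g y"]) measurable
  also have "(\<integral>\<^sup>+u. 4 * g (1 / u) * ennreal (1 / (1 + u\<^sup>2)) * indicator {0<..} u \<partial>lborel)
      = 4 * (\<integral>\<^sup>+u. g (1 / u) * ennreal (1 / (1 + u\<^sup>2)) * indicator {0<..} u \<partial>lborel)"
    unfolding mult.assoc by (rule nn_integral_cmult) measurable
  also have "(\<integral>\<^sup>+u. g (1 / u) * ennreal (1 / (1 + u\<^sup>2)) * indicator {0<..} u \<partial>lborel)
      = (\<integral>\<^sup>+t. ennreal (log_kernel a t) * indicator {0..1} t \<partial>lborel)"
    unfolding g_def using nn_integral_log_plus_plane [OF a] by simp
  finally show ?thesis
    by (simp flip: mult.assoc)
qed

section \<open>The Mahler measure as an integral of the kernel\<close>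

text \<open>Tonelli's theorem for the product measure over a three-element index type, one coordinate at a time.\<close>

lemma nn_integral_PiM_3:
  fixes h :: "real \<Rightarrow> real \<Rightarrow> real \<Rightarrow> ennreal"
  assumes [measurable]: "(\<lambda>(x, y, z). h x y z) \<in> borel_measurable (borel \<Otimes>\<^sub>M borel \<Otimes>\<^sub>M borel)"
  shows "(\<integral>\<^sup>+\<theta>. h (\<theta> 1) (\<theta> 2) (\<theta> 3) \<partial>(\<Pi>\<^sub>M i\<in>(UNIV :: 3 set). lborel))
       = (\<integral>\<^sup>+x. \<integral>\<^sup>+y. \<integral>\<^sup>+z. h x y z \<partial>lborel \<partial>lborel \<partial>lborel)"
proof -
  interpret product_sigma_finite "\<lambda>_ :: 3. lborel :: real measure"
    by standard
  have h: "(\<lambda>\<omega>. h (f \<omega>) (g \<omega>) (k \<omega>)) \<in> borel_measurable M"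
    if [measurable]: "f \<in> borel_measurable M" "g \<in> borel_measurable M" "k \<in> borel_measurable M"
    for f g k and M :: "'b measure"
  proof -
    have "(\<lambda>\<omega>. (\<lambda>(x, y, z). h x y z) (f \<omega>, g \<omega>, k \<omega>)) \<in> borel_measurable M"
      by measurable
    then show ?thesis by simp
  qed
  have U: "(UNIV :: 3 set) = insert 1 (insert 2 {3})"
    using UNIV_3 by auto
  have comp: "(\<lambda>\<theta>. \<theta> i) \<in> borel_measurable (\<Pi>\<^sub>M i\<in>I. lborel)" if "i \<in> I" for i :: 3 and I
    using measurable_component_singleton [OF that, of "\<lambda>_. lborel"] by simp
  have "(\<integral>\<^sup>+\<theta>. h (\<theta> 1) (\<theta> 2) (\<theta> 3) \<partial>(\<Pi>\<^sub>M i\<in>(UNIV :: 3 set). lborel))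
      = (\<integral>\<^sup>+x. \<integral>\<^sup>+\<theta>. h x (\<theta> 2) (\<theta> 3) \<partial>(\<Pi>\<^sub>M i\<in>insert 2 {3 :: 3}. lborel) \<partial>lborel)"
    unfolding U by (subst product_nn_integral_insert_rev) (auto intro!: h comp)
  also have "\<dots> = (\<integral>\<^sup>+x. \<integral>\<^sup>+y. \<integral>\<^sup>+\<theta>. h x y (\<theta> 3) \<partial>(\<Pi>\<^sub>M i\<in>{3 :: 3}. lborel) \<partial>lborel \<partial>lborel)"
    by (rule nn_integral_cong, subst product_nn_integral_insert_rev) (auto intro!: h comp)
  also have "\<dots> = (\<integral>\<^sup>+x. \<integral>\<^sup>+y. \<integral>\<^sup>+z. h x y z \<partial>lborel \<partial>lborel \<partial>lborel)"
    by (intro nn_integral_cong, subst product_nn_integral_singleton) (auto intro!: h)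
  finally show ?thesis .
qed

lemma borel_measurable_cis [measurable]: "cis \<in> borel_measurable borel"
  by (intro borel_measurable_continuous_onI continuous_intros)

lemma cos_half_neq_0:
  assumes "x \<in> {0..2*pi}" "x \<noteq> pi"
  shows "cos (x / 2) \<noteq> 0"
proof
  assume "cos (x / 2) = 0"
  then have "x / 2 = pi / 2"
    by - (rule cos_inj_pi, use assms in auto)
  with assms show False by simp
qed

lemma norm_coefficients_le:
  assumes "a > 0"
  shows "norm ((1 + cis x) * (1 + cis y)) \<le> 4"
    and "norm (of_real a * (1 - cis x) * (1 - cis y)) \<le> 4 * a"
proof -
  have le2: "norm (1 + cis t) \<le> 2" "norm (1 - cis t) \<le> 2" for t
    by (auto intro: norm_triangle_le norm_triangle_le_diff)
  show "norm ((1 + cis x) * (1 + cis y)) \<le> 4"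
    using mult_mono [OF le2(1) [of x] le2(1) [of y]] by (simp add: norm_mult)
  show "norm (of_real a * (1 - cis x) * (1 - cis y)) \<le> 4 * a"
    using mult_left_mono [OF mult_mono [OF le2(2) [of x] le2(2) [of y]], of a] assms
    by (simp only: norm_mult norm_of_real) simp
qed

text \<open>The mean of \<open>ln \<bar>1 + cis x\<bar>\<close> is zero. It is subtracted from \<open>K \<ge> ln 2\<close>, the maximum of the logarithm, so
that the integrand is nonnegative.\<close>

lemma nn_integral_ln_norm_one_plus_cis:
  assumes "m \<ge> 0" "K \<ge> ln 2"
  shows "(\<integral>\<^sup>+x. ennreal (m * (K - ln (norm (1 + cis x)))) * indicator {0..2*pi} x \<partial>lborel)
       = ennreal (m * (2 * pi * K))"
proof (rule nn_integral_has_integral_lebesgue')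
  have "((\<lambda>x. ln (norm (1 - (-1) * cis x))) has_integral 0) {0..2*pi}"
    by (rule ln_norm_circle_on) simp
  from has_integral_mult_right [OF has_integral_diff [OF has_integral_const_real [of K 0 "2 * pi"] this], of m]
  show "((\<lambda>x. m * (K - ln (norm (1 + cis x)))) has_integral m * (2 * pi * K)) {0..2*pi}"
    by simp
  fix x
  have "norm (1 + cis x) \<le> 2"
    by (rule norm_triangle_le) simp
  then have "ln (norm (1 + cis x)) \<le> ln 2"
    by (cases "1 + cis x = 0") simp_all
  with assms show "0 \<le> m * (K - ln (norm (1 + cis x)))"
    by simp
qed

text \<open>Here \<open>N x y\<close> is the larger of the two coefficients of the polynomial in \<open>y\<close>. Away from \<open>x = pi\<close> and
\<open>y = pi\<close>, where the constant coefficient vanishes,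
\<open>C - ln (N x y) + ln (max 1 (a \<bar>tan (x/2) tan (y/2)\<bar>)) = C - ln \<bar>1 + cis x\<bar> - ln \<bar>1 + cis y\<bar>\<close>.
The second summand on the left is moved to that side, and subtracted only after integration, because
extended nonnegative integrals are additive but not subtractive. Its integral is \<open>16 I\<close>, and the
right-hand side integrates to \<open>4 pi\<^sup>2 C\<close>.\<close>

lemma nn_integral_ln_max_torus:
  fixes a C I :: real
  defines "N \<equiv> \<lambda>x y. max (norm ((1 + cis x) * (1 + cis y)))
                 (norm (of_real a * (1 - cis x) * (1 - cis y)))"
  assumes a: "a > 0" and C: "C = ln (4 + 4 * a)"
    and I: "(log_kernel a has_integral I) {0..1}"
  shows "(\<integral>\<^sup>+x. \<integral>\<^sup>+y. ennreal (C - ln (N x y)) * indicator {0..2*pi} x * indicator {0..2*pi} y \<partial>lborel \<partial>lborel)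
       = ennreal (4 * pi\<^sup>2 * C - 16 * I)" (is "?X = _")
    and "16 * I \<le> 4 * pi\<^sup>2 * C"
proof -
  define Q where "Q = (\<lambda>x y. ln (max 1 (a * \<bar>tan (x / 2)\<bar> * \<bar>tan (y / 2)\<bar>)))"
  have I0: "I \<ge> 0"
    using I by (rule has_integral_nonneg) (use a in \<open>auto intro: log_kernel_nonneg\<close>)
  have C2: "C \<ge> 2 * ln 2"
  proof -
    have "2 * ln 2 = ln (4 :: real)"
      using ln_realpow [of 2 2] by simp
    then show ?thesis using a by (simp add: C)
  qed
  have NC: "ln (N x y) \<le> C" for x y
  proof -
    have N4: "N x y \<le> 4 + 4 * a"
      using norm_coefficients_le [OF a, of x y] a unfolding N_def by linarith
    show ?thesis
    proof (cases "N x y > 0")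
      case True
      with N4 show ?thesis by (simp add: C)
    next
      case False
      then have "N x y = 0" using norm_ge_zero [of "(1 + cis x) * (1 + cis y)"] unfolding N_def by linarith
      then show ?thesis using C2 by (simp add: order_trans [OF _ C2])
    qed
  qed
  have Q0: "Q x y \<ge> 0" for x y
    by (simp add: Q_def)
  have sum: "C - ln (N x y) + Q x y = (C - ln (norm (1 + cis x))) - ln (norm (1 + cis y))"
    if "x \<in> {0..2*pi}" "x \<noteq> pi" "y \<in> {0..2*pi}" "y \<noteq> pi" for x y
  proof -
    have c: "cos (x / 2) \<noteq> 0" "cos (y / 2) \<noteq> 0"
      by (rule cos_half_neq_0; use that in simp)+
    let ?n = "norm (1 + cis x) * norm (1 + cis y)"
    have n: "norm (1 + cis x) > 0" "norm (1 + cis y) > 0"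
      using c unfolding norm_one_plus_cis by auto
    have ct: "\<bar>sin u\<bar> = \<bar>cos u\<bar> * \<bar>tan u\<bar>" if "cos u \<noteq> 0" for u :: real
      using that by (simp add: tan_def)
    have "N x y = max (?n * 1) (?n * (a * \<bar>tan (x / 2)\<bar> * \<bar>tan (y / 2)\<bar>))"
      unfolding N_def norm_mult norm_one_plus_cis norm_one_minus_cis
      using a c by (simp add: ct mult_ac)
    also have "\<dots> = ?n * max 1 (a * \<bar>tan (x / 2)\<bar> * \<bar>tan (y / 2)\<bar>)"
      by (simp add: max_mult_distrib_left)
    finally show ?thesis
      using n by (simp add: Q_def ln_mult)
  qed
  have [measurable]: "(\<lambda>(x, y). ennreal (C - ln (N x y))) \<in> borel_measurable (borel \<Otimes>\<^sub>M borel)"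
    unfolding N_def by measurable
  have [measurable]: "(tan :: real \<Rightarrow> real) \<in> borel_measurable borel"
    unfolding tan_def by measurable
  have [measurable]: "(\<lambda>(x, y). ennreal (Q x y)) \<in> borel_measurable (borel \<Otimes>\<^sub>M borel)"
    unfolding Q_def by measurable
  let ?J = "{0..2*pi}"
  have Q_int: "(\<integral>\<^sup>+x. \<integral>\<^sup>+y. ennreal (Q x y) * indicator ?J x * indicator ?J y \<partial>lborel \<partial>lborel) = ennreal (16 * I)"
  proof -
    have "(\<integral>\<^sup>+x. \<integral>\<^sup>+y. ennreal (Q x y) * indicator ?J x * indicator ?J y \<partial>lborel \<partial>lborel)
        = (\<integral>\<^sup>+x. (\<integral>\<^sup>+y. ennreal (Q x y) * indicator ?J y \<partial>lborel) * indicator ?J x \<partial>lborel)"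
      by (intro nn_integral_cong) (auto split: split_indicator)
    also have "\<dots> = 16 * (\<integral>\<^sup>+t. ennreal (log_kernel a t) * indicator {0..1} t \<partial>lborel)"
      unfolding Q_def by (rule nn_integral_log_plus_torus [OF a])
    also have "(\<integral>\<^sup>+t. ennreal (log_kernel a t) * indicator {0..1} t \<partial>lborel) = ennreal I"
      using I by (intro nn_integral_has_integral_lebesgue') (use a in \<open>auto intro: log_kernel_nonneg\<close>)
    also have "16 * ennreal I = ennreal (16 * I)"
      using I0 by (simp add: ennreal_mult)
    finally show ?thesis .
  qed
  have "?X + ennreal (16 * I)
      = (\<integral>\<^sup>+x. \<integral>\<^sup>+y. ennreal (C - ln (N x y)) * indicator ?J x * indicator ?J y +
                    ennreal (Q x y) * indicator ?J x * indicator ?J y \<partial>lborel \<partial>lborel)"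
    unfolding Q_int [symmetric]
    by (subst nn_integral_add [symmetric]; measurable?) (intro nn_integral_cong nn_integral_add [symmetric]; measurable)
  also have "\<dots> = (\<integral>\<^sup>+x. ennreal (2 * pi * (C - ln (norm (1 + cis x)))) * indicator ?J x \<partial>lborel)"
  proof (rule nn_integral_cong_AE, rule AE_mp [OF AE_lborel_singleton [of pi]], rule AE_I2, rule impI)
    fix x :: real assume x: "x \<noteq> pi"
    show "(\<integral>\<^sup>+y. ennreal (C - ln (N x y)) * indicator ?J x * indicator ?J y +
                    ennreal (Q x y) * indicator ?J x * indicator ?J y \<partial>lborel)
        = ennreal (2 * pi * (C - ln (norm (1 + cis x)))) * indicator ?J x"
    proof (cases "x \<in> ?J")
      case True
      have "norm (1 + cis x) \<le> 2"
        by (rule norm_triangle_le) simp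
      moreover have "norm (1 + cis x) > 0"
        using cos_half_neq_0 [OF True x] unfolding norm_one_plus_cis by auto
      ultimately have lx: "ln (norm (1 + cis x)) \<le> ln 2"
        by simp
      have "(\<integral>\<^sup>+y. ennreal (C - ln (N x y)) * indicator ?J x * indicator ?J y +
                    ennreal (Q x y) * indicator ?J x * indicator ?J y \<partial>lborel)
          = (\<integral>\<^sup>+y. ennreal (1 * ((C - ln (norm (1 + cis x))) - ln (norm (1 + cis y)))) * indicator ?J y \<partial>lborel)"
      proof (rule nn_integral_cong_AE, rule AE_mp [OF AE_lborel_singleton [of pi]], rule AE_I2, rule impI)
        fix y :: real assume y: "y \<noteq> pi"
        show "ennreal (C - ln (N x y)) * indicator ?J x * indicator ?J y +
                    ennreal (Q x y) * indicator ?J x * indicator ?J y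
           = ennreal (1 * ((C - ln (norm (1 + cis x))) - ln (norm (1 + cis y)))) * indicator ?J y"
        proof (cases "y \<in> ?J")
          case True
          then show ?thesis
            using NC [of x y] Q0 [of x y] \<open>x \<in> ?J\<close> sum [OF \<open>x \<in> ?J\<close> x True y]
            by (simp flip: ennreal_plus)
        qed simp
      qed
      also have "\<dots> = ennreal (1 * (2 * pi * (C - ln (norm (1 + cis x)))))"
        using lx C2 by (intro nn_integral_ln_norm_one_plus_cis) auto
      finally show ?thesis
        using True by simp
    qed simp
  qed
  also have "\<dots> = ennreal (2 * pi * (2 * pi * C))"
    using C2 by (intro nn_integral_ln_norm_one_plus_cis) (auto intro: order_trans [of _ "2 * ln 2"])
  finally have eq: "?X + ennreal (16 * I) = ennreal (4 * pi\<^sup>2 * C)"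
    by (simp add: power2_eq_square mult_ac)
  have "ennreal (16 * I) \<le> ennreal (4 * pi\<^sup>2 * C)"
    unfolding eq [symmetric] by (rule add_increasing) auto
  then show "16 * I \<le> 4 * pi\<^sup>2 * C"
    using C2 by (subst (asm) ennreal_le_iff) (auto intro!: mult_nonneg_nonneg order_trans [OF _ C2])
  have "?X = (?X + ennreal (16 * I)) - ennreal (16 * I)"
    by (rule ennreal_add_diff_cancel_right [symmetric]) simp
  also have "\<dots> = ennreal (4 * pi\<^sup>2 * C) - ennreal (16 * I)"
    by (simp only: eq)
  also have "\<dots> = ennreal (4 * pi\<^sup>2 * C - 16 * I)"
    using I0 by (simp add: ennreal_minus)
  finally show "?X = ennreal (4 * pi\<^sup>2 * C - 16 * I)" .
qed

text \<open>Integrate \<open>C - ln \<bar>P\<bar> \<ge> 0\<close>, where \<open>4 + 4 a\<close> bounds \<open>\<bar>P\<bar>\<close> on the torus: first over the angle of \<open>y\<close>, by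
\<open>ln_norm_circle_linear\<close>, and then over the other two, by \<open>nn_integral_ln_max_torus\<close>. Finiteness of the
result shows that \<open>ln \<bar>P\<bar>\<close> is integrable, so that \<open>C\<close> can be subtracted again.\<close>

lemma mahler_measure_eq_integral_log_kernel:
  fixes a I :: real
  assumes a: "a > 0" and I: "(log_kernel a has_integral I) {0..1}"
  shows "pi\<^sup>2 * mahler_measure ((1 + Var 1) * (1 + Var 2) +
            Const (of_real a) * (1 - Var 1) * (1 - Var 2) * Var 3 :: 3 cpoly) = 4 * I"
proof -
  define C where "C = ln (4 + 4 * a)"
  define P where "P = (\<lambda>x y z. (1 + cis x) * (1 + cis y) + of_real a * (1 - cis x) * (1 - cis y) * cis z)"
  define M where "M = (\<Pi>\<^sub>M i\<in>(UNIV :: 3 set). (lborel :: real measure))"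
  define S where "S = (UNIV :: 3 set) \<rightarrow>\<^sub>E {0..2*pi}"
  let ?J = "{0..2*pi}"
  define N where "N = (\<lambda>x y. max (norm ((1 + cis x) * (1 + cis y)))
                 (norm (of_real a * (1 - cis x) * (1 - cis y))))"
  have C0: "C > 0"
    using a by (simp add: C_def)
  have PC: "ln (norm (P x y z)) \<le> C" for x y z
  proof (cases "P x y z = 0")
    case False
    have "norm (P x y z) \<le> 4 + 4 * a"
      unfolding P_def
    proof (rule norm_triangle_le)
      have "norm (of_real a * (1 - cis x) * (1 - cis y) * cis z) = norm (of_real a * (1 - cis x) * (1 - cis y))"
        by (simp add: norm_mult)
      then show "norm ((1 + cis x) * (1 + cis y)) + norm (of_real a * (1 - cis x) * (1 - cis y) * cis z) \<le> 4 + 4 * a"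
        using norm_coefficients_le [OF a, of x y] by linarith
    qed
    with False show ?thesis
      unfolding C_def using a by (subst ln_le_cancel_iff) auto
  qed (use C0 in simp)
  have S: "indicator S \<theta> = (indicator ?J (\<theta> 1) * indicator ?J (\<theta> 2) * indicator ?J (\<theta> 3) :: real)" for \<theta>
    by (auto simp: S_def PiE_def extensional_def forall_3 Pi_def indicator_def)
  have comp: "(\<lambda>\<theta>. \<theta> i) \<in> borel_measurable M" for i :: 3
    unfolding M_def using measurable_component_singleton [of i UNIV "\<lambda>_. lborel"] by simp
  define g where "g = (\<lambda>\<theta>. indicator S \<theta> * (C - ln (norm (P (\<theta> 1) (\<theta> 2) (\<theta> 3)))))"
  have [measurable]: "g \<in> borel_measurable M"
    unfolding g_def S P_def supply comp [measurable] by measurable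
  have g0: "g \<theta> \<ge> 0" for \<theta>
    using PC by (simp add: g_def)
  have inner: "(\<integral>\<^sup>+z. ennreal (C - ln (norm (P x y z))) * indicator ?J z \<partial>lborel)
      = ennreal (2 * pi * (C - ln (N x y)))" if "x \<in> ?J" "x \<noteq> pi" "y \<in> ?J" "y \<noteq> pi" for x y
  proof (rule nn_integral_has_integral_lebesgue')
    have c: "cos (x / 2) \<noteq> 0" "cos (y / 2) \<noteq> 0"
      by (rule cos_half_neq_0; use that in simp)+
    then have "norm (1 + cis x) > 0" "norm (1 + cis y) > 0"
      unfolding norm_one_plus_cis by auto
    then have "(1 + cis x) * (1 + cis y) \<noteq> 0"
      by simp
    from ln_norm_circle_linear [OF this, of "of_real a * (1 - cis x) * (1 - cis y)"]
    have "((\<lambda>z. ln (norm (P x y z))) has_integral 2 * pi * ln (N x y)) ?J"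
      by (simp add: P_def N_def)
    from has_integral_diff [OF has_integral_const_real [of C 0 "2 * pi"] this]
    show "((\<lambda>z. C - ln (norm (P x y z))) has_integral 2 * pi * (C - ln (N x y))) ?J"
      by (simp add: algebra_simps)
  qed (use PC in simp)
  have "integral\<^sup>N M g = (\<integral>\<^sup>+x. \<integral>\<^sup>+y. \<integral>\<^sup>+z. ennreal (indicator ?J x * indicator ?J y * indicator ?J z * (C - ln (norm (P x y z)))) \<partial>lborel \<partial>lborel \<partial>lborel)"
    unfolding M_def g_def S by (rule nn_integral_PiM_3) (unfold P_def, measurable)
  also have "\<dots> = (\<integral>\<^sup>+x. \<integral>\<^sup>+y. ennreal (2 * pi) * (ennreal (C - ln (N x y)) * indicator ?J x * indicator ?J y) \<partial>lborel \<partial>lborel)"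
  proof (rule nn_integral_cong_AE, rule AE_mp [OF AE_lborel_singleton [of pi]], rule AE_I2, rule impI,
         rule nn_integral_cong_AE, rule AE_mp [OF AE_lborel_singleton [of pi]], rule AE_I2, rule impI)
    fix x y :: real assume xy: "x \<noteq> pi" "y \<noteq> pi"
    show "(\<integral>\<^sup>+z. ennreal (indicator ?J x * indicator ?J y * indicator ?J z * (C - ln (norm (P x y z)))) \<partial>lborel)
        = ennreal (2 * pi) * (ennreal (C - ln (N x y)) * indicator ?J x * indicator ?J y)"
    proof (cases "x \<in> ?J \<and> y \<in> ?J")
      case True
      have "(\<integral>\<^sup>+z. ennreal (indicator ?J x * indicator ?J y * indicator ?J z * (C - ln (norm (P x y z)))) \<partial>lborel)
          = (\<integral>\<^sup>+z. ennreal (C - ln (norm (P x y z))) * indicator ?J z \<partial>lborel)"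
        using True by (intro nn_integral_cong) (auto split: split_indicator)
      also have "\<dots> = ennreal (2 * pi * (C - ln (N x y)))"
        using True xy by (intro inner) auto
      finally show ?thesis
        using True by (simp add: ennreal_mult')
    qed (auto split: split_indicator)
  qed
  also have "\<dots> = ennreal (2 * pi) * (\<integral>\<^sup>+x. \<integral>\<^sup>+y. ennreal (C - ln (N x y)) * indicator ?J x * indicator ?J y \<partial>lborel \<partial>lborel)"
  proof -
    have [measurable]: "(\<lambda>(x, y). ennreal (C - ln (N x y))) \<in> borel_measurable (borel \<Otimes>\<^sub>M borel)"
      unfolding N_def by measurable
    have "(\<integral>\<^sup>+x. \<integral>\<^sup>+y. ennreal (2 * pi) * (ennreal (C - ln (N x y)) * indicator ?J x * indicator ?J y) \<partial>lborel \<partial>lborel)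
        = (\<integral>\<^sup>+x. ennreal (2 * pi) * (\<integral>\<^sup>+y. ennreal (C - ln (N x y)) * indicator ?J x * indicator ?J y \<partial>lborel) \<partial>lborel)"
      by (intro nn_integral_cong nn_integral_cmult) measurable
    also have "\<dots> = ennreal (2 * pi) * (\<integral>\<^sup>+x. \<integral>\<^sup>+y. ennreal (C - ln (N x y)) * indicator ?J x * indicator ?J y \<partial>lborel \<partial>lborel)"
      by (rule nn_integral_cmult) measurable
    finally show ?thesis .
  qed
  also have "\<dots> = ennreal (2 * pi) * ennreal (4 * pi\<^sup>2 * C - 16 * I)"
    unfolding N_def by (simp only: nn_integral_ln_max_torus [OF a C_def I])
  also have "\<dots> = ennreal (2 * pi * (4 * pi\<^sup>2 * C - 16 * I))"
    by (simp add: ennreal_mult')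
  finally have ng: "integral\<^sup>N M g = ennreal (2 * pi * (4 * pi\<^sup>2 * C - 16 * I))" .
  have g: "integrable M g" "integral\<^sup>L M g = 2 * pi * (4 * pi\<^sup>2 * C - 16 * I)"
    using nn_integral_eq_integrable [of g M "2 * pi * (4 * pi\<^sup>2 * C - 16 * I)"] ng g0
      nn_integral_ln_max_torus(2) [OF a C_def I] by auto
  (* The integral of the constant, to recover ln |P| as the difference of two integrable functions. *)
  define k where "k = (\<lambda>\<theta>. C * indicator S \<theta>)"
  have [measurable]: "k \<in> borel_measurable M"
    unfolding k_def S supply comp [measurable] by measurable
  have "integral\<^sup>N M k = (\<integral>\<^sup>+x. \<integral>\<^sup>+y. \<integral>\<^sup>+z. ennreal (C * (indicator ?J x * indicator ?J y * indicator ?J z)) \<partial>lborel \<partial>lborel \<partial>lborel)"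
    unfolding M_def k_def S by (rule nn_integral_PiM_3) measurable
  also have "\<dots> = (\<integral>\<^sup>+x. \<integral>\<^sup>+y. \<integral>\<^sup>+z. ennreal C * indicator ?J x * indicator ?J y * indicator ?J z \<partial>lborel \<partial>lborel \<partial>lborel)"
    by (intro nn_integral_cong) (auto split: split_indicator)
  also have "\<dots> = ennreal (C * (2 * pi) ^ 3)"
    using C0 by (simp add: nn_integral_cmult nn_integral_multc ennreal_mult' power3_eq_cube mult_ac flip: ennreal_mult'')
  finally have nk: "integral\<^sup>N M k = ennreal (C * (2 * pi) ^ 3)" .
  have "k \<theta> \<ge> 0" for \<theta>
    using C0 by (simp add: k_def)
  then have k: "integrable M k" "integral\<^sup>L M k = C * (2 * pi) ^ 3"
    using nn_integral_eq_integrable [of k M "C * (2 * pi) ^ 3"] nk C0 \<open>k \<in> borel_measurable M\<close> by auto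
  have "(LINT \<theta> : S | M. ln (norm (P (\<theta> 1) (\<theta> 2) (\<theta> 3)))) = integral\<^sup>L M (\<lambda>\<theta>. k \<theta> - g \<theta>)"
    unfolding set_lebesgue_integral_def by (rule Bochner_Integration.integral_cong) (auto simp: k_def g_def algebra_simps)
  also have "\<dots> = 32 * pi * I"
    using g k by (simp add: power3_eq_cube power2_eq_square algebra_simps)
  finally have "(LINT \<theta> : S | M. ln (norm (P (\<theta> 1) (\<theta> 2) (\<theta> 3)))) = 32 * pi * I" .
  then show ?thesis
    unfolding mahler_measure_def
    by (simp add: S_def M_def P_def power3_eq_cube power2_eq_square field_simps)
qed

section \<open>Polylogarithms inside the unit disc\<close>

lemma summable_power_div_power:
  fixes a :: real
  assumes "0 \<le> a" "a < 1"
  shows "summable (\<lambda>k. a ^ (2 * k + 1) / real (2 * k + 1) ^ r)"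
proof (rule summable_comparison_test')
  have "a\<^sup>2 < 1" using assms by (simp add: power_less_one_iff abs_square_less_1)
  then show "summable (\<lambda>k. a\<^sup>2 ^ k)"
    by (intro summable_geometric) simp
  fix k :: nat
  have "norm (a ^ (2 * k + 1) / real (2 * k + 1) ^ r) = a ^ (2 * k + 1) / real (2 * k + 1) ^ r"
    using assms by simp
  also have "\<dots> \<le> a ^ (2 * k + 1) / 1"
    using assms by (intro divide_left_mono) (auto simp del: of_nat_add of_nat_mult intro: one_le_power)
  also have "\<dots> \<le> a\<^sup>2 ^ k"
    using assms by (simp add: power_mult mult_left_le_one_le)
  finally show "norm (a ^ (2 * k + 1) / real (2 * k + 1) ^ r) \<le> a\<^sup>2 ^ k" .
qed

definition legendre_chi :: "nat \<Rightarrow> real \<Rightarrow> real" where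
  "legendre_chi r x = suminf (\<lambda>k. x ^ (2 * k + 1) / real (2 * k + 1) ^ r)"

lemma sums_legendre_chi:
  assumes "0 \<le> x" "x < 1"
  shows "(\<lambda>k. x ^ (2 * k + 1) / real (2 * k + 1) ^ r) sums legendre_chi r x"
  unfolding legendre_chi_def by (intro summable_sums summable_power_div_power assms)

text \<open>For \<open>a < 1\<close> all terms of the expanded kernel are nonnegative on \<open>{0..1}\<close>, so monotone convergence allows
termwise integration.\<close>

lemma has_integral_log_kernel_series:
  assumes a: "0 < a" "a < 1"
  shows "(log_kernel a has_integral
           (2 * legendre_chi 3 a - ln a * legendre_chi 2 a)) {0..1}"
proof -
  define f where "f = (\<lambda>k t. a ^ (2 * k + 1) * (t ^ (2 * k) * ln t ^ 2 + ln a * (t ^ (2 * k) * ln t)))"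
  define c where "c = (\<lambda>k. 2 * (a ^ (2 * k + 1) / real (2 * k + 1) ^ 3) - ln a * (a ^ (2 * k + 1) / real (2 * k + 1) ^ 2))"
  have f: "(f k has_integral c k) {0..1}" for k
  proof -
    have "(f k has_integral a ^ (2 * k + 1) * (2 / real (Suc (2 * k)) ^ 3 + ln a * (- 1 / real (Suc (2 * k)) ^ 2))) {0..1}"
      unfolding f_def
      by (intro has_integral_mult_right has_integral_add has_integral_power_mult_ln has_integral_power_mult_ln_sq)
    then show ?thesis
      by (simp add: c_def algebra_simps)
  qed
  have c: "c sums (2 * legendre_chi 3 a - ln a * legendre_chi 2 a)"
    unfolding c_def using a by (intro sums_diff sums_mult sums_legendre_chi) auto
  have sm: "((\<lambda>t. \<Sum>k<n. f k t) has_integral (\<Sum>k<n. c k)) {0..1}" for n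
    using f by (intro has_integral_sum) auto
  have f0: "f k t \<ge> 0" if "t \<in> {0..1}" for k t
  proof (cases "t = 0")
    case False
    then have "ln t * (ln t + ln a) \<ge> 0"
      using that a by (intro mult_nonpos_nonpos add_nonpos_nonpos) auto
    moreover have "0 \<le> a ^ (2 * k + 1) * t ^ (2 * k)"
      using that a by auto
    ultimately have "0 \<le> a ^ (2 * k + 1) * t ^ (2 * k) * (ln t * (ln t + ln a))"
      by (rule mult_nonneg_nonneg [rotated])
    then show ?thesis by (simp add: f_def power2_eq_square algebra_simps)
  qed (simp add: f_def)
  have "log_kernel a integrable_on {0..1} \<and>
     (\<lambda>n. integral {0..1} (\<lambda>t. \<Sum>k<n. f k t)) \<longlonglongrightarrow> integral {0..1} (log_kernel a)"
  proof (rule monotone_convergence_increasing)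
    show "(\<lambda>t. \<Sum>k<n. f k t) integrable_on {0..1}" for n
      using sm by blast
    show "(\<Sum>k<n. f k t) \<le> (\<Sum>k<Suc n. f k t)" if "t \<in> {0..1}" for n t
      using f0 [OF that] by simp
    show "bounded (range (\<lambda>n. integral {0..1} (\<lambda>t. \<Sum>k<n. f k t)))"
      unfolding integral_unique [OF sm]
      using c by (intro convergent_imp_bounded) (simp add: sums_def)
    show "(\<lambda>n. \<Sum>k<n. f k t) \<longlonglongrightarrow> log_kernel a t" if t: "t \<in> {0..1}" for t
    proof -
      have "a * t < 1" "a * t \<ge> 0"
        using a t by (auto intro: le_less_trans [OF mult_left_le])
      then have "norm ((a * t)\<^sup>2) < 1"
        by (simp add: abs_square_less_1)
      then have "(\<lambda>k. (a * (ln t ^ 2 + ln a * ln t)) * ((a * t)\<^sup>2) ^ k) sums ((a * (ln t ^ 2 + ln a * ln t)) * (1 / (1 - (a * t)\<^sup>2)))"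
        by (intro sums_mult geometric_sums)
      also have "(\<lambda>k. (a * (ln t ^ 2 + ln a * ln t)) * ((a * t)\<^sup>2) ^ k) = (\<lambda>k. f k t)"
        by (simp add: f_def power_mult [symmetric] power_mult_distrib algebra_simps)
      also have "(a * (ln t ^ 2 + ln a * ln t)) * (1 / (1 - (a * t)\<^sup>2)) = log_kernel a t"
        by (simp add: log_kernel_def power_mult_distrib power2_eq_square algebra_simps add_divide_distrib)
      finally show ?thesis by (simp add: sums_def)
    qed
  qed
  then show ?thesis
    using c unfolding integral_unique [OF sm] sums_def
    by (metis LIMSEQ_unique has_integral_integral)
qed

text \<open>The difference keeps only the odd powers, twice each.\<close>

lemma polylog_series_odd:
  fixes a :: real
  assumes a: "0 < a" "a < 1"
  shows "polylog \<gamma> r (of_real a) - polylog \<gamma> r (- of_real a)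
       = of_real (2 * legendre_chi r a)"
proof -
  have S: "summable (\<lambda>k. x ^ Suc k / real (Suc k) ^ r)" if "\<bar>x\<bar> < 1" for x
  proof (rule summable_comparison_test')
    show "summable (\<lambda>k. \<bar>x\<bar> ^ k)"
      using that by (intro summable_geometric) simp
    fix k :: nat
    have "norm (x ^ Suc k / real (Suc k) ^ r) = \<bar>x\<bar> ^ Suc k / real (Suc k) ^ r"
      by (simp add: power_abs abs_mult)
    also have "\<dots> \<le> \<bar>x\<bar> ^ Suc k / 1"
      by (intro divide_left_mono) (auto simp del: of_nat_Suc intro: one_le_power)
    also have "\<dots> \<le> \<bar>x\<bar> ^ k"
      using that by (simp add: mult_left_le_one_le)
    finally show "norm (x ^ Suc k / real (Suc k) ^ r) \<le> \<bar>x\<bar> ^ k" .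
  qed
  have P: "polylog \<gamma> r (of_real x) = of_real (suminf (\<lambda>k. x ^ Suc k / real (Suc k) ^ r))" if "\<bar>x\<bar> < 1" for x
    using that suminf_of_real [OF S [OF that], where 'a = complex] by (simp add: polylog_def)
  define d where "d = (\<lambda>k. a ^ Suc k / real (Suc k) ^ r - (- a) ^ Suc k / real (Suc k) ^ r)"
  have d: "d sums (suminf (\<lambda>k. a ^ Suc k / real (Suc k) ^ r) - suminf (\<lambda>k. (- a) ^ Suc k / real (Suc k) ^ r))"
    unfolding d_def using a by (intro sums_diff summable_sums S) auto
  have "(\<lambda>k. d (2 * k)) sums c \<longleftrightarrow> d sums c" for c
  proof (rule sums_mono_reindex)
    show "strict_mono (\<lambda>k::nat. 2 * k)" by (simp add: strict_mono_def)
    fix n assume "n \<notin> range (\<lambda>k::nat. 2 * k)"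
    then have "odd n" by (auto elim!: evenE)
    then show "d n = 0" by (simp add: d_def)
  qed
  with d have 1: "(\<lambda>k. d (2 * k)) sums (suminf (\<lambda>k. a ^ Suc k / real (Suc k) ^ r) - suminf (\<lambda>k. (- a) ^ Suc k / real (Suc k) ^ r))"
    by simp
  have 2: "(\<lambda>k. d (2 * k)) = (\<lambda>k. 2 * (a ^ (2 * k + 1) / real (2 * k + 1) ^ r))"
    by (simp add: d_def)
  have 3: "(\<lambda>k. 2 * (a ^ (2 * k + 1) / real (2 * k + 1) ^ r)) sums (2 * legendre_chi r a)"
    using a by (intro sums_mult sums_legendre_chi) auto
  have "suminf (\<lambda>k. a ^ Suc k / real (Suc k) ^ r) - suminf (\<lambda>k. (- a) ^ Suc k / real (Suc k) ^ r)
      = 2 * legendre_chi r a"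
    using sums_unique2 [OF 1 [unfolded 2] 3] .
  with P [of a] P [of "- a"] a show ?thesis
    by (simp flip: of_real_minus of_real_diff)
qed

section \<open>Polylogarithms as single integrals along a path\<close>

lemma norm_integral_le_Ioo:
  fixes f :: "real \<Rightarrow> complex" and g :: "real \<Rightarrow> real"
  assumes f: "f integrable_on {a..b}" and g: "g integrable_on {a..b}"
    and le: "\<And>v. a < v \<Longrightarrow> v < b \<Longrightarrow> norm (f v) \<le> g v"
  shows "norm (integral {a..b} f) \<le> integral {a..b} g"
  unfolding integral_open_interval_real
proof (rule Henstock_Kurzweil_Integration.integral_norm_bound_integral)
  show "f integrable_on {a<..<b}" "g integrable_on {a<..<b}"
    using f g by (simp_all add: integrable_on_Icc_iff_Ioo)
qed (use le in auto)

text \<open>The integrands below are unbounded at the endpoints, so continuity is available only at interior points.\<close>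

lemma integral_has_vector_derivative_interior:
  fixes h :: "real \<Rightarrow> complex"
  assumes h: "h integrable_on {a..b}" and u: "a < u" "u < b" and c: "isCont h u"
  shows "((\<lambda>x. integral {a..x} h) has_vector_derivative h u) (at u)"
proof -
  have "((\<lambda>x. integral {a..x} h) has_vector_derivative h u) (at u within ({a..b} - {}))"
    using u c by (intro integral_has_vector_derivative_continuous_at [OF h]) (auto intro: continuous_at_imp_continuous_at_within)
  then show ?thesis
    using u by (simp add: at_within_Icc_at)
qed

text \<open>This collects what the reduction of iterated integrals requires of a path \<open>\<gamma>\<close>: \<open>L\<close> stands for the
logarithm along \<open>\<gamma>\<close> and \<open>f\<close> for the pulled-back form \<open>dt / (t - 1/z)\<close>. The form may have a pole at the end
of the path (this happens for \<open>z = 1\<close>), where \<open>L\<close> vanishes. The decay of \<open>norm (L u)\<close> along the path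
takes the place of pointwise estimates near the endpoints: it bounds \<open>L u\<close> times an integral up to \<open>u\<close> by
an integral with \<open>L\<close> inside.\<close>

locale log_path_form =
  fixes L f :: "real \<Rightarrow> complex" and C D :: real
  assumes L_cont: "continuous_on {0<..<1} L"
    and f_cont: "continuous_on {0..<1} f"
    and L_bound: "\<And>u. 0 < u \<Longrightarrow> u < 1 \<Longrightarrow> norm (L u) \<le> C * (1 - ln u)"
    and fL_bound: "\<And>u. 0 < u \<Longrightarrow> u < 1 \<Longrightarrow> norm (f u * L u) \<le> D * (1 - ln u)"
    and L_antimono: "\<And>u v. 0 < u \<Longrightarrow> u \<le> v \<Longrightarrow> v < 1 \<Longrightarrow> norm (L v) \<le> norm (L u)"
    and L_tendsto: "(L \<longlongrightarrow> 0) (at_left 1)"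
    and L_1: "L 1 = 0"
begin

lemma weighted_absolutely_integrable:
  "(\<lambda>u. f u * L u) absolutely_integrable_on {0..1}" (is ?th1)
  "(\<lambda>u. f u * L u ^ 2) absolutely_integrable_on {0..1}" (is ?th2)
proof -
  have f': "continuous_on {0<..<1} f"
    using f_cont by (rule continuous_on_subset) auto
  have fLm: "(\<lambda>u. f u * L u) \<in> borel_measurable (lebesgue_on {0<..<1})"
    "(\<lambda>u. f u * L u ^ 2) \<in> borel_measurable (lebesgue_on {0<..<1})"
    by (intro continuous_imp_measurable_on_sets_lebesgue continuous_intros L_cont f'; simp)+
  have "(\<lambda>u. D + (- D) * ln u + 0 * ln u ^ 2) integrable_on {0..1}"
    by (rule integrable_ln_polynomial)
  moreover have "norm (f u * L u) \<le> D + (- D) * ln u + 0 * ln u ^ 2" if "u \<in> {0<..<1}" for u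
    using fL_bound [of u] that by (simp add: algebra_simps)
  ultimately show ?th1
    unfolding absolutely_integrable_on_Icc_iff_Ioo integrable_on_Icc_iff_Ioo
    by (intro measurable_bounded_by_integrable_imp_absolutely_integrable [OF fLm(1)]) auto
  have "(\<lambda>u. D * C + (- 2 * D * C) * ln u + D * C * ln u ^ 2) integrable_on {0..1}"
    by (rule integrable_ln_polynomial)
  moreover have "norm (f u * L u ^ 2) \<le> D * C + (- 2 * D * C) * ln u + D * C * ln u ^ 2" if u: "u \<in> {0<..<1}" for u
  proof -
    have "norm (f u * L u ^ 2) = norm (f u * L u) * norm (L u)"
      by (simp add: norm_mult power2_eq_square)
    also have "\<dots> \<le> (D * (1 - ln u)) * (C * (1 - ln u))"
      using u L_bound fL_bound by (intro mult_mono' norm_ge_zero) auto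
    finally show ?thesis by (simp add: power2_eq_square algebra_simps)
  qed
  ultimately show ?th2
    unfolding absolutely_integrable_on_Icc_iff_Ioo integrable_on_Icc_iff_Ioo
    by (intro measurable_bounded_by_integrable_imp_absolutely_integrable [OF fLm(2)]) auto
qed

text \<open>\<open>J 0\<close> is the innermost iterated integral. The next ones are \<open>L J 0 - J 1\<close> and
\<open>L\<^sup>2 J 0 / 2 - L J 1 + J 2 / 2\<close>, by repeated integration by parts.\<close>

definition J :: "nat \<Rightarrow> real \<Rightarrow> complex" where
  "J n u = integral {0..u} (\<lambda>v. f v * L v ^ n)"

definition K :: "nat \<Rightarrow> real \<Rightarrow> real" where
  "K n u = integral {0..u} (\<lambda>v. norm (f v * L v ^ n))"

lemma f_integrable: "0 \<le> u \<Longrightarrow> v < 1 \<Longrightarrow> f integrable_on {u..v}"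
  by (intro integrable_continuous_real continuous_on_subset [OF f_cont]) auto

lemma fL_integrable:
  assumes "n = 1 \<or> n = 2"
  shows "(\<lambda>v. f v * L v ^ n) integrable_on {0..1}" "(\<lambda>v. norm (f v * L v ^ n)) integrable_on {0..1}"
  using weighted_absolutely_integrable assms by (auto simp: absolutely_integrable_on_def)

lemma JK_continuous:
  assumes "n = 1 \<or> n = 2"
  shows "continuous_on {0..1} (J n)" "continuous_on {0..1} (K n)"
  unfolding J_def K_def by (intro indefinite_integral_continuous_1 fL_integrable assms)+

lemma isCont_f_L: "0 < u \<Longrightarrow> u < 1 \<Longrightarrow> isCont f u" "0 < u \<Longrightarrow> u < 1 \<Longrightarrow> isCont L u"
  using f_cont L_cont
  by (auto simp: continuous_on_eq_continuous_at dest: continuous_on_subset [of _ f "{0<..<1}"])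

lemma J_derivative:
  assumes u: "0 < u" "u < 1" and n: "n \<le> 2"
  shows "(J n has_vector_derivative f u * L u ^ n) (at u)"
proof -
  define b where "b = (u + 1) / 2"
  have "(\<lambda>v. f v * L v ^ n) integrable_on {0..b}"
  proof (cases "n = 0")
    case True
    then show ?thesis using f_integrable [of 0 b] u by (simp add: b_def)
  next
    case False
    then have "n = 1 \<or> n = 2" using n by auto
    from fL_integrable(1) [OF this] show ?thesis
      by (rule integrable_subinterval_real) (use u in \<open>auto simp: b_def\<close>)
  qed
  then show ?thesis
    unfolding J_def using u
    by (intro integral_has_vector_derivative_interior [where b = b] continuous_intros isCont_f_L) (auto simp: b_def)
qed

text \<open>Under the integral over \<open>{0..u}\<close> the outer factor \<open>L u\<close> is at most the inner \<open>L v\<close> in norm.\<close>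

lemma norm_L_mult_J_le:
  assumes u: "0 < u" "u < 1" and mn: "n + m = 1 \<or> n + m = 2"
  shows "norm (L u ^ m * J n u) \<le> K (n + m) u"
proof -
  have "norm (integral {0..u} (\<lambda>v. L u ^ m * (f v * L v ^ n))) \<le> K (n + m) u"
    unfolding K_def
  proof (rule norm_integral_le_Ioo)
    show "(\<lambda>v. norm (f v * L v ^ (n + m))) integrable_on {0..u}"
      by (rule integrable_subinterval_real [OF fL_integrable(2) [OF mn]]) (use u in auto)
    have "(\<lambda>v. f v * L v ^ n) integrable_on {0..u}"
    proof (cases "n = 0")
      case True
      then show ?thesis using f_integrable [of 0 u] u by simp
    next
      case False
      then have "n = 1 \<or> n = 2" using mn by auto
      from fL_integrable(1) [OF this] show ?thesis
        by (rule integrable_subinterval_real) (use u in auto)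
    qed
    then show "(\<lambda>v. L u ^ m * (f v * L v ^ n)) integrable_on {0..u}"
      by (rule integrable_on_mult_right)
    fix v assume v: "0 < v" "v < u"
    have "norm (L u ^ m) \<le> norm (L v ^ m)"
      using L_antimono [of v u] u v by (simp add: norm_power power_mono)
    then have "norm (f v * L v ^ n) * norm (L u ^ m) \<le> norm (f v * L v ^ n) * norm (L v ^ m)"
      by (rule mult_left_mono) simp
    then show "norm (L u ^ m * (f v * L v ^ n)) \<le> norm (f v * L v ^ (n + m))"
      by (simp add: norm_mult power_add mult_ac)
  qed
  then show ?thesis
    by (simp add: J_def)
qed

lemma L_mult_J_tendsto_0:
  assumes mn: "n + m = 1 \<or> n + m = 2"
  shows "((\<lambda>u. L u ^ m * J n u) \<longlongrightarrow> 0) (at_right 0)"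
proof (rule Lim_null_comparison)
  show "\<forall>\<^sub>F u in at_right 0. norm (L u ^ m * J n u) \<le> K (n + m) u"
    using norm_L_mult_J_le [OF _ _ mn] by (auto simp: eventually_at_right_field intro!: exI [of _ 1])
  have "(K (n + m) \<longlongrightarrow> K (n + m) 0) (at_right 0)"
    using JK_continuous(2) [OF mn] by (auto dest: continuous_on_Icc_at_rightD)
  then show "(K (n + m) \<longlongrightarrow> 0) (at_right 0)"
    by (simp add: K_def)
qed

text \<open>The integral \<open>J 0\<close> may diverge at \<open>1\<close>. It is split at a point \<open>d\<close> beyond which the integral of
\<open>norm (f L)\<close> is small: up to \<open>d\<close> the factor \<open>L u\<close> tends to zero, and beyond \<open>d\<close> it is absorbed into the
integral.\<close>

lemma L_mult_J0_tendsto_1: "((\<lambda>u. L u * J 0 u) \<longlongrightarrow> 0) (at_left 1)"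
proof (rule tendstoI)
  fix e :: real assume e: "e > 0"
  have "(K 1 \<longlongrightarrow> K 1 1) (at_left 1)"
    using JK_continuous(2) [of 1] by (auto dest: continuous_on_Icc_at_leftD)
  then have "\<forall>\<^sub>F d in at_left 1. dist (K 1 d) (K 1 1) < e / 2"
    by (rule tendstoD) (use e in simp)
  moreover have "\<forall>\<^sub>F d in at_left (1::real). d \<in> {0<..<1}"
    by (rule eventually_at_leftI [of 0]) auto
  ultimately have "\<forall>\<^sub>F d in at_left (1::real). d \<in> {0<..<1} \<and> dist (K 1 d) (K 1 1) < e / 2"
    by eventually_elim auto
  then obtain d where d: "0 < d" "d < 1" "dist (K 1 d) (K 1 1) < e / 2"
    using eventually_happens [of _ "at_left (1::real)"] by (auto simp: trivial_limit_at_left_real)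
  have "((\<lambda>u. L u * J 0 d) \<longlongrightarrow> 0 * J 0 d) (at_left 1)"
    by (intro tendsto_intros L_tendsto)
  then have "\<forall>\<^sub>F u in at_left 1. dist (L u * J 0 d) 0 < e / 2"
    by (intro tendstoD) (use e in auto)
  moreover have "\<forall>\<^sub>F u in at_left (1::real). u \<in> {d<..<1}"
    by (rule eventually_at_leftI [of d]) (use d in auto)
  ultimately show "\<forall>\<^sub>F u in at_left 1. dist (L u * J 0 u) 0 < e"
  proof eventually_elim
    case (elim u)
    have u: "0 < u" "d < u" "u < 1" using elim d by auto
    have "J 0 u = J 0 d + integral {d..u} f"
      using u d f_integrable [of 0 u]
      by (simp add: J_def Henstock_Kurzweil_Integration.integral_combine)
    then have "norm (L u * J 0 u) \<le> norm (L u * J 0 d) + norm (L u * integral {d..u} f)"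
      by (simp add: distrib_left norm_triangle_ineq)
    also have "norm (L u * integral {d..u} f) \<le> integral {d..u} (\<lambda>v. norm (f v * L v ^ 1))"
    proof -
      have "norm (integral {d..u} (\<lambda>v. L u * f v)) \<le> integral {d..u} (\<lambda>v. norm (f v * L v ^ 1))"
      proof (rule norm_integral_le_Ioo)
        show "(\<lambda>v. norm (f v * L v ^ 1)) integrable_on {d..u}"
          by (rule integrable_subinterval_real [OF fL_integrable(2)]) (use u d in auto)
        show "(\<lambda>v. L u * f v) integrable_on {d..u}"
          using d u by (intro integrable_on_mult_right f_integrable) auto
        fix v assume v: "d < v" "v < u"
        then have "norm (f v) * norm (L u) \<le> norm (f v) * norm (L v)"
          using L_antimono [of v u] u d by (intro mult_left_mono) auto
        then show "norm (L u * f v) \<le> norm (f v * L v ^ 1)"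
          by (simp add: norm_mult mult_ac)
      qed
      then show ?thesis by simp
    qed
    also have "integral {d..u} (\<lambda>v. norm (f v * L v ^ 1)) = K 1 u - K 1 d"
    proof -
      have "(\<lambda>v. norm (f v * L v ^ 1)) integrable_on {0..u}"
        by (rule integrable_subinterval_real [OF fL_integrable(2)]) (use u in auto)
      from Henstock_Kurzweil_Integration.integral_combine [OF _ _ this, of d] show ?thesis
        using u d by (simp add: K_def)
    qed
    also have "K 1 u \<le> K 1 1"
      unfolding K_def
      by (intro integral_subset_le integrable_subinterval_real [OF fL_integrable(2)] fL_integrable(2)) (use u in auto)
    finally show ?case
      using elim(1) d(3) unfolding dist_norm diff_zero real_norm_def by linarith
  qed
qed

text \<open>The two antiderivatives are those of the comment on \<open>J\<close>; what has to be shown is that they extend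
continuously to both endpoints. At \<open>1\<close> the terms with a factor \<open>L\<close> disappear.\<close>

lemma integral_log_weight:
  fixes w :: "real \<Rightarrow> complex"
  assumes L': "\<And>u. 0 < u \<Longrightarrow> u < 1 \<Longrightarrow> (L has_vector_derivative w u) (at u)"
  shows "\<And>u. 0 \<le> u \<Longrightarrow> u \<le> 1 \<Longrightarrow>
           ((\<lambda>v. w v * J 0 v) has_integral (L u * J 0 u - J 1 u)) {0..u}"
    and "((\<lambda>v. w v * (L v * J 0 v - J 1 v)) has_integral J 2 1 / 2) {0..1}"
proof -
  let ?F = "\<lambda>u. L u * J 0 u - J 1 u"
  let ?G = "\<lambda>u. L u ^ 2 * J 0 u / 2 - L u * J 1 u + J 2 u / 2"
  have cont: "isCont (J n) u" "isCont L u" if "0 < u" "u < 1" "n \<le> 2" for u n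
    using has_vector_derivative_continuous [OF J_derivative [OF that]] isCont_f_L(2) [OF that(1,2)] by auto
  have J1: "(J n \<longlongrightarrow> J n 1) (at_left 1)" and J0: "(J n \<longlongrightarrow> 0) (at_right 0)" if "n = 1 \<or> n = 2" for n
    using continuous_on_Icc_at_leftD [OF JK_continuous(1) [OF that]]
      continuous_on_Icc_at_rightD [OF JK_continuous(1) [OF that]] by (auto simp: J_def)
  have F_cont: "continuous_on {0..1} ?F"
  proof (rule continuous_on_IccI)
    show "(?F \<longlongrightarrow> ?F 0) (at_right 0)"
      using tendsto_diff [OF L_mult_J_tendsto_0 [of 0 1] J0 [of 1]] by (simp add: J_def)
    show "(?F \<longlongrightarrow> ?F 1) (at_left 1)"
      using tendsto_diff [OF L_mult_J0_tendsto_1 J1 [of 1]] by (simp add: L_1)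
    show "?F \<midarrow>u\<rightarrow> ?F u" if "0 < u" "u < 1" for u
    proof -
      have "isCont ?F u" using that by (intro continuous_intros cont) auto
      then show ?thesis by (simp add: isCont_def)
    qed
  qed simp
  have G_cont: "continuous_on {0..1} ?G"
  proof (rule continuous_on_IccI)
    have "(?G \<longlongrightarrow> 0 / 2 - 0 + 0 / 2) (at_right 0)"
      using L_mult_J_tendsto_0 [of 0 2] L_mult_J_tendsto_0 [of 1 1] J0 [of 2]
      by (intro tendsto_add tendsto_diff tendsto_divide tendsto_const) auto
    then show "(?G \<longlongrightarrow> ?G 0) (at_right 0)"
      by (simp add: J_def)
    have "((\<lambda>u. L u * (L u * J 0 u) / 2 - L u * J 1 u + J 2 u / 2) \<longlongrightarrow> 0 * 0 / 2 - 0 * J 1 1 + J 2 1 / 2) (at_left 1)"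
      by (intro tendsto_intros L_tendsto L_mult_J0_tendsto_1 J1) auto
    then show "(?G \<longlongrightarrow> ?G 1) (at_left 1)"
      by (simp add: L_1 power2_eq_square mult.assoc)
    show "?G \<midarrow>u\<rightarrow> ?G u" if "0 < u" "u < 1" for u
    proof -
      have "isCont ?G u" using that by (intro continuous_intros cont) auto
      then show ?thesis by (simp add: isCont_def)
    qed
  qed simp
  have F': "(?F has_vector_derivative w u * J 0 u) (at u)" if u: "0 < u" "u < 1" for u
  proof -
    have "(?F has_vector_derivative (L u * (f u * L u ^ 0) + w u * J 0 u) - f u * L u ^ 1) (at u)"
      using u by (intro has_vector_derivative_diff has_vector_derivative_mult J_derivative L') auto
    then show ?thesis by (simp add: algebra_simps)
  qed
  show "((\<lambda>v. w v * J 0 v) has_integral ?F u) {0..u}" if "0 \<le> u" "u \<le> 1" for u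
  proof -
    have "((\<lambda>v. w v * J 0 v) has_integral (?F u - ?F 0)) {0..u}"
      using that F' by (intro fundamental_theorem_of_calculus_interior continuous_on_subset [OF F_cont]) auto
    then show ?thesis by (simp add: J_def)
  qed
  have "((\<lambda>v. w v * ?F v) has_integral (?G 1 - ?G 0)) {0..1}"
  proof (intro fundamental_theorem_of_calculus_interior G_cont)
    fix u :: real assume "u \<in> {0<..<1}"
    then have u: "0 < u" "u < 1" by auto
    have L2: "((\<lambda>u. L u ^ 2) has_vector_derivative L u * w u + w u * L u) (at u)"
      unfolding power2_eq_square using u by (intro has_vector_derivative_mult L')
    have "(?G has_vector_derivative
        (L u ^ 2 * (f u * L u ^ 0) + (L u * w u + w u * L u) * J 0 u) / 2
        - (L u * (f u * L u ^ 1) + w u * J 1 u) + (f u * L u ^ 2) / 2) (at u)"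
      using u by (intro has_vector_derivative_add has_vector_derivative_diff has_vector_derivative_divide has_vector_derivative_mult J_derivative L' L2) auto
    moreover have "(L u ^ 2 * (f u * L u ^ 0) + (L u * w u + w u * L u) * J 0 u) / 2
        - (L u * (f u * L u ^ 1) + w u * J 1 u) + (f u * L u ^ 2) / 2 = w u * ?F u"
      by (simp add: field_simps power2_eq_square)
    ultimately show "(?G has_vector_derivative w u * ?F u) (at u)" by simp
  qed simp
  then show "((\<lambda>v. w v * ?F v) has_integral J 2 1 / 2) {0..1}"
    by (simp add: L_1) (simp add: J_def)
qed

end

text \<open>On paper, \<open>Li\<^sub>2(z) = \<integral> Log t / (t - 1/z) dt\<close> and \<open>Li\<^sub>3(z) = - 1/2 \<integral> (Log t)\<^sup>2 / (t - 1/z) dt\<close>: the integrals of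
\<open>dt/t\<close> from \<open>t\<close> to the endpoint \<open>1\<close> are carried out first.\<close>

lemma polylog_eq_single_integral:
  fixes \<gamma> d :: "real \<Rightarrow> complex" and z :: complex
  assumes z: "norm z \<ge> 1"
    and d: "\<And>u. u \<in> {0..1} \<Longrightarrow> vector_derivative \<gamma> (at u within {0..1}) = d u"
    and L': "\<And>u. 0 < u \<Longrightarrow> u < 1 \<Longrightarrow> (L has_vector_derivative d u / \<gamma> u) (at u)"
    and "log_path_form L (\<lambda>u. d u / (\<gamma> u - 1 / z)) C D"
  shows "((\<lambda>u. d u / (\<gamma> u - 1 / z) * L u) has_integral polylog \<gamma> 2 z) {0..1}"
    and "((\<lambda>u. d u / (\<gamma> u - 1 / z) * L u ^ 2) has_integral - 2 * polylog \<gamma> 3 z) {0..1}"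
proof -
  define f where "f = (\<lambda>u. d u / (\<gamma> u - 1 / z))"
  interpret log_path_form L f C D
    using assms(4) by (simp add: f_def)
  have L'': "(L has_vector_derivative d u / \<gamma> u) (at u)" if "0 < u" "u < 1" for u
    using L' that .
  note I = integral_log_weight [OF L'']
  have I1: "iterated_integral \<gamma> [\<lambda>t. 1 / (t - 1 / z)] u = J 0 u" if "u \<in> {0..1}" for u
    unfolding J_def using that by (auto simp: f_def d intro!: integral_cong)
  have I2: "iterated_integral \<gamma> [\<lambda>t. 1 / t, \<lambda>t. 1 / (t - 1 / z)] u = L u * J 0 u - J 1 u" if u: "u \<in> {0..1}" for u
  proof -
    have "iterated_integral \<gamma> [\<lambda>t. 1 / t, \<lambda>t. 1 / (t - 1 / z)] u = integral {0..u} (\<lambda>v. d v / \<gamma> v * J 0 v)"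
      unfolding iterated_integral.simps(2) [of _ _ "[_]"]
      by (rule integral_cong) (use u in \<open>simp only: I1 d atLeastAtMost_iff order_trans [of _ u 1] simp_thms\<close>, simp)
    also have "\<dots> = L u * J 0 u - J 1 u"
      using u by (intro integral_unique I) auto
    finally show ?thesis .
  qed
  have I3: "iterated_integral \<gamma> [\<lambda>t. 1 / t, \<lambda>t. 1 / t, \<lambda>t. 1 / (t - 1 / z)] 1 = J 2 1 / 2"
  proof -
    have "iterated_integral \<gamma> [\<lambda>t. 1 / t, \<lambda>t. 1 / t, \<lambda>t. 1 / (t - 1 / z)] 1
        = integral {0..1} (\<lambda>v. d v / \<gamma> v * (L v * J 0 v - J 1 v))"
      unfolding iterated_integral.simps(2) [of _ _ "[_, _]"]
      by (rule integral_cong) (simp only: I2 d, simp)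
    also have "\<dots> = J 2 1 / 2"
      by (intro integral_unique I)
    finally show ?thesis .
  qed
  have J: "((\<lambda>v. f v * L v ^ n) has_integral J n 1) {0..1}" if "n = 1 \<or> n = 2" for n
    unfolding J_def using fL_integrable(1) [OF that] by (rule integrable_integral)
  have "polylog \<gamma> 2 z = J 1 1"
    using z I2 [of 1] by (simp add: polylog_def L_1 del: iterated_integral.simps)
  then show "((\<lambda>u. d u / (\<gamma> u - 1 / z) * L u) has_integral polylog \<gamma> 2 z) {0..1}"
    using J [of 1] by (simp add: f_def)
  have "polylog \<gamma> 3 z = - (J 2 1 / 2)"
    using z I3 by (simp add: polylog_def numeral_2_eq_2 del: iterated_integral.simps)
  then show "((\<lambda>u. d u / (\<gamma> u - 1 / z) * L u ^ 2) has_integral - 2 * polylog \<gamma> 3 z) {0..1}"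
    using J [of 2] by (simp add: f_def)
qed

text \<open>The partial fractions \<open>1 / (t - 1/a) - 1 / (t + 1/a) = - 2 a / (1 - a\<^sup>2 t\<^sup>2)\<close> combine the two poles into
the logarithmic kernel, with the principal logarithm along the path in place of the real one.\<close>

lemma odd_polylog_has_integral:
  fixes \<gamma> d L :: "real \<Rightarrow> complex"
  assumes a: "a \<ge> 1" and \<gamma>: "polylog_path (of_real a) = \<gamma>"
    and d: "\<And>u. u \<in> {0..1} \<Longrightarrow> vector_derivative \<gamma> (at u within {0..1}) = d u"
    and L': "\<And>u. 0 < u \<Longrightarrow> u < 1 \<Longrightarrow> (L has_vector_derivative d u / \<gamma> u) (at u)"
    and F1: "log_path_form L (\<lambda>u. d u / (\<gamma> u - 1 / of_real a)) C D"
    and F2: "log_path_form L (\<lambda>u. d u / (\<gamma> u - 1 / (- of_real a))) C' D'"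
    and ne: "\<And>u. 0 < u \<Longrightarrow> u < 1 \<Longrightarrow> of_real a * \<gamma> u \<noteq> 1 \<and> of_real a * \<gamma> u \<noteq> -1"
  shows "((\<lambda>u. 4 * (d u * (of_real a * L u * (of_real (ln a) + L u) / (1 - (of_real a * \<gamma> u)\<^sup>2))))
           has_integral (4 * odd_polylog a 3 1 - 2 * odd_polylog_log a 2 1)) {0..1}"
proof -
  let ?a = "complex_of_real a"
  let ?f = "\<lambda>z u. d u / (\<gamma> u - 1 / z)"
  have z: "norm ?a \<ge> 1" "norm (- ?a) \<ge> 1" using a by auto
  note I = polylog_eq_single_integral [OF z(1) d L' F1] polylog_eq_single_integral [OF z(2) d L' F2]
  have R: "4 * odd_polylog a 3 1 - 2 * odd_polylog_log a 2 1 =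
     (- 2) * (- 2 * polylog \<gamma> 3 ?a - (- 2 * polylog \<gamma> 3 (- ?a))) -
     2 * of_real (ln a) * (polylog \<gamma> 2 ?a - polylog \<gamma> 2 (- ?a))"
    using a \<gamma> by (simp add: odd_polylog_def odd_polylog_log_def Let_def algebra_simps)
  have "((\<lambda>u. (- 2) * (?f ?a u * L u ^ 2 - ?f (- ?a) u * L u ^ 2)
          - 2 * of_real (ln a) * (?f ?a u * L u - ?f (- ?a) u * L u)) has_integral
       (4 * odd_polylog a 3 1 - 2 * odd_polylog_log a 2 1)) {0..1}"
    unfolding R by (intro has_integral_diff has_integral_mult_right I)
  then have "((\<lambda>u. (- 2) * (?f ?a u * L u ^ 2 - ?f (- ?a) u * L u ^ 2)
          - 2 * of_real (ln a) * (?f ?a u * L u - ?f (- ?a) u * L u)) has_integral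
       (4 * odd_polylog a 3 1 - 2 * odd_polylog_log a 2 1)) {0<..<1}"
    by (simp only: has_integral_Icc_iff_Ioo)
  then have "((\<lambda>u. 4 * (d u * (of_real a * L u * (of_real (ln a) + L u) / (1 - (of_real a * \<gamma> u)\<^sup>2))))
           has_integral (4 * odd_polylog a 3 1 - 2 * odd_polylog_log a 2 1)) {0<..<1}"
  proof (rule has_integral_eq [rotated])
    fix u :: real assume u: "u \<in> {0<..<1}"
    define g where "g = ?a * \<gamma> u"
    have g: "g - 1 \<noteq> 0" "g + 1 \<noteq> 0" "1 - g\<^sup>2 \<noteq> 0"
      using ne [of u] u by (auto simp: g_def power2_eq_1_iff add_eq_0_iff2)
    have a0: "?a \<noteq> 0" using a by auto
    have "\<gamma> u - 1 / ?a = (g - 1) / ?a" "\<gamma> u - 1 / (- ?a) = (g + 1) / ?a"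
      using a0 by (simp_all add: g_def field_simps)
    then have e1: "?f ?a u = d u * ?a / (g - 1)" and e2: "?f (- ?a) u = d u * ?a / (g + 1)"
      by simp_all
    have "?f ?a u - ?f (- ?a) u = d u * ?a * (1 / (g - 1) - 1 / (g + 1))"
      unfolding e1 e2 by (simp add: right_diff_distrib)
    also have "1 / (g - 1) - 1 / (g + 1) = - 2 / (1 - g\<^sup>2)"
      using g by (simp add: field_simps power2_eq_square)
    finally have e: "?f ?a u - ?f (- ?a) u = d u * ?a * (- 2 / (1 - g\<^sup>2))" .
    have alg: "(- 2) * (p * l ^ 2 - q * l ^ 2) - 2 * k * (p * l - q * l) = (- 2) * (p - q) * (l * (k + l))"
      for p q l k :: complex
      by (simp add: power2_eq_square algebra_simps)
    have "(- 2) * (?f ?a u * L u ^ 2 - ?f (- ?a) u * L u ^ 2)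
          - 2 * of_real (ln a) * (?f ?a u * L u - ?f (- ?a) u * L u)
       = (- 2) * (?f ?a u - ?f (- ?a) u) * (L u * (of_real (ln a) + L u))"
      by (rule alg)
    also have "\<dots> = 4 * (d u * (?a * L u * (of_real (ln a) + L u) / (1 - g\<^sup>2)))"
      unfolding e by simp
    finally show "(- 2) * (?f ?a u * L u ^ 2 - ?f (- ?a) u * L u ^ 2)
          - 2 * of_real (ln a) * (?f ?a u * L u - ?f (- ?a) u * L u)
       = 4 * (d u * (?a * L u * (of_real (ln a) + L u) / (1 - (?a * \<gamma> u)\<^sup>2)))"
      by (simp only: g_def)
  qed
  then show ?thesis
    by (simp only: has_integral_Icc_iff_Ioo)
qed

text \<open>For \<open>a = 1\<close> the pole of \<open>dt / (t - 1)\<close> sits at the endpoint of the segment, where \<open>ln\<close> vanishes.\<close>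

lemma odd_polylog_one:
  assumes I: "(log_kernel 1 has_integral I) {0..1}"
  shows "4 * odd_polylog 1 3 1 - 2 * odd_polylog_log 1 2 1 = of_real (4 * I)"
proof -
  let ?L = "\<lambda>u. complex_of_real (ln u)"
  have lp: "log_path_form ?L (\<lambda>u. 1 / (linepath 0 1 u - 1 / z)) 1 1" if z: "z = 1 \<or> z = - 1" for z :: complex
  proof
    show "continuous_on {0<..<1} ?L"
      by (intro continuous_intros) auto
    have lin: "linepath 0 1 u - 1 / z = of_real (u - 1) \<or> linepath 0 1 u - 1 / z = of_real (u + 1)" for u
      using z by (auto simp: linepath_def scaleR_conv_of_real)
    have ne: "linepath 0 1 u - 1 / z \<noteq> 0" if "u \<in> {0..<1}" for u
      using lin [of u] that by (metis add_nonneg_eq_0_iff atLeastLessThan_iff less_irrefl of_real_eq_0_iff right_minus_eq zero_le_one zero_neq_one)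
    then show "continuous_on {0..<1} (\<lambda>u. 1 / (linepath 0 1 u - 1 / z))"
      by (intro continuous_intros) auto
    show "norm (?L u) \<le> 1 * (1 - ln u)" if "0 < u" "u < 1" for u
      using that by (simp add: abs_if)
    show "norm (1 / (linepath 0 1 u - 1 / z) * ?L u) \<le> 1 * (1 - ln u)" if u: "0 < u" "u < 1" for u
    proof -
      have lu: "ln u < 0" using u by simp
      have "norm (linepath 0 1 u - 1 / z) = \<bar>u - 1\<bar> \<or> norm (linepath 0 1 u - 1 / z) = \<bar>u + 1\<bar>"
        using lin [of u] by (metis norm_of_real)
      then have "norm (linepath 0 1 u - 1 / z) \<ge> 1 - u"
        using u by linarith
      then have "(- ln u) / norm (linepath 0 1 u - 1 / z) \<le> (- ln u) / (1 - u)"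
        using u lu by (intro frac_le) auto
      moreover have "norm (1 / w * ?L u) = (- ln u) / norm w" for w :: complex
        using lu by (simp add: norm_divide norm_mult)
      ultimately have "norm (1 / (linepath 0 1 u - 1 / z) * ?L u) \<le> (- ln u) / (1 - u)"
        by (simp only:)
      also have "\<dots> \<le> 1 - ln u"
        using minus_ln_le [of u] u by (subst pos_divide_le_eq) (simp_all add: mult.commute)
      finally show ?thesis by simp
    qed
    show "norm (?L v) \<le> norm (?L u)" if "0 < u" "u \<le> v" "v < 1" for u v
      using that by (simp add: abs_if)
    have "(ln \<longlongrightarrow> ln 1) (at_left (1::real))"
      by (intro tendsto_intros) auto
    then have "(?L \<longlongrightarrow> of_real (ln 1)) (at_left 1)"
      by (intro tendsto_of_real)
    then show "(?L \<longlongrightarrow> 0) (at_left 1)" by simp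
  qed simp
  have "((\<lambda>u. 4 * (1 * (of_real 1 * ?L u * (of_real (ln 1) + ?L u) / (1 - (of_real 1 * linepath 0 1 u)\<^sup>2))))
           has_integral (4 * odd_polylog 1 3 1 - 2 * odd_polylog_log 1 2 1)) {0..1}"
  proof (rule odd_polylog_has_integral)
    show "polylog_path (of_real 1) = linepath 0 1"
      by (subst polylog_path_of_real) auto
    show "vector_derivative (linepath 0 1) (at u within {0..1}) = (1::complex)" if "u \<in> {0..1}" for u
      using that by (simp add: vector_derivative_linepath_within)
    show "(?L has_vector_derivative 1 / linepath 0 1 u) (at u)" if "0 < u" "u < 1" for u
    proof -
      have "(?L has_vector_derivative of_real (1 / u)) (at u)"
        using that by (intro has_vector_derivative_of_real DERIV_ln_divide)
      then show ?thesis by (simp add: linepath_def scaleR_conv_of_real)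
    qed
    show "of_real 1 * linepath 0 1 u \<noteq> 1 \<and> of_real 1 * linepath 0 1 u \<noteq> (-1 :: complex)" if "0 < u" "u < 1" for u
      using that by (auto simp: linepath_def scaleR_conv_of_real complex_eq_iff)
    show "log_path_form ?L (\<lambda>u. 1 / (linepath 0 1 u - 1 / of_real 1)) 1 1"
      using lp [of 1] by simp
    show "log_path_form ?L (\<lambda>u. 1 / (linepath 0 1 u - 1 / (- of_real 1))) 1 1"
      using lp [of "- 1"] by simp
  qed simp
  moreover have "((\<lambda>u. complex_of_real (4 * log_kernel 1 u)) has_integral of_real (4 * I)) {0..1}"
    by (intro has_integral_of_real has_integral_mult_right I)
  moreover have "(\<lambda>u. complex_of_real (4 * log_kernel 1 u)) = (\<lambda>u. 4 * (1 * (of_real 1 * ?L u * (of_real (ln 1) + ?L u) / (1 - (of_real 1 * linepath 0 1 u)\<^sup>2))))"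
    by (simp add: log_kernel_def linepath_def scaleR_conv_of_real)
  ultimately show ?thesis
    by (metis has_integral_unique)
qed

section \<open>The semicircular path\<close>

text \<open>A crude form of Jordan's inequality; any linear lower bound serves to estimate \<open>ln (sin x)\<close> by \<open>ln x\<close>.\<close>

lemma half_le_sin:
  assumes "0 \<le> x" "x \<le> pi / 2"
  shows "x / 2 \<le> sin x"
proof -
  define y where "y = x / 2"
  have y: "0 \<le> y" "y < pi / 2" "x = 2 * y"
    unfolding y_def using assms pi_gt_zero by linarith+
  have cy: "cos y > 0"
    using y by (intro cos_gt_zero_pi) auto
  have ty: "y \<le> tan y"
    using abs_tan_ge [of y] y tan_gt_zero [of y] by (cases "y = 0") auto
  have "cos x \<ge> 0"
    using assms by (intro cos_ge_zero) auto
  then have "1 / 2 \<le> (cos y)\<^sup>2"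
    using cos_double_cos [of y] y by simp
  then have "2 * y * (1 / 2) \<le> 2 * tan y * (cos y)\<^sup>2"
    using ty y by (intro mult_mono) auto
  also have "\<dots> = sin x"
    using cy by (simp add: y(3) sin_double tan_def power2_eq_square)
  finally show ?thesis by (simp add: y_def)
qed

text \<open>In terms of half the angle, \<open>(1 + exp (\<i> \<theta>)) / 2 = cos (\<theta> / 2) exp (\<i> \<theta> / 2)\<close> with
\<open>\<theta> = pi u - pi\<close>. This product form exhibits the logarithm.\<close>

lemma semicircle_eq:
  "part_circlepath (1/2) (1/2) (- pi) 0 u
     = Complex ((sin (pi * u / 2))\<^sup>2) (- sin (pi * u / 2) * cos (pi * u / 2))"
proof -
  define v where "v = pi * u / 2"
  have l: "linepath (- pi) 0 u = 2 * v - pi"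
    by (simp add: linepath_def v_def algebra_simps)
  have "part_circlepath (1/2) (1/2) (- pi) 0 u = 1/2 + 1/2 * cis (2 * v - pi)"
    unfolding part_circlepath_def l by (simp add: cis_conv_exp)
  also have "\<dots> = Complex ((sin v)\<^sup>2) (- sin v * cos v)"
    by (simp add: complex_eq_iff cos_diff sin_diff cos_double_sin sin_double diff_divide_distrib)
  finally show ?thesis by (simp add: v_def)
qed

lemma semicircle_vector_derivative:
  assumes "u \<in> {0..1}"
  shows "vector_derivative (part_circlepath (1/2) (1/2) (- pi) 0) (at u within {0..1})
       = of_real (pi / 2) * (- \<i>) * (Complex (cos (pi * u / 2)) (sin (pi * u / 2)))\<^sup>2"
proof -
  define v where "v = pi * u / 2"
  have l: "linepath (- pi) 0 u = 2 * v - pi"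
    by (simp add: linepath_def v_def algebra_simps)
  have "vector_derivative (part_circlepath (1/2) (1/2) (- pi) 0) (at u within {0..1})
      = of_real (pi / 2) * \<i> * cis (2 * v - pi)"
    using assms by (subst vector_derivative_part_circlepath01) (auto simp: l cis_conv_exp)
  also have "cis (2 * v - pi) = - (cis v)\<^sup>2"
    by (simp add: power2_eq_square cis_mult) (simp add: complex_eq_iff cos_diff sin_diff)
  also have "cis v = Complex (cos v) (sin v)"
    by (simp add: complex_eq_iff)
  finally show ?thesis by (simp add: v_def)
qed

text \<open>The logarithm along the semicircle, read off from the polar form of its points.\<close>

definition arc_log :: "real \<Rightarrow> complex" where
  "arc_log u = Complex (ln (sin (pi * u / 2))) (pi * (u - 1) / 2)"

lemma sin_half_pi_pos:
  assumes "0 < u" "u \<le> 1"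
  shows "0 < sin (pi * u / 2)" "u / 2 \<le> sin (pi * u / 2)"
proof -
  show "0 < sin (pi * u / 2)"
    using assms by (intro sin_gt_zero) (auto simp: field_simps intro: order_le_less_trans [of _ "pi * 1"])
  have "pi * u / 2 / 2 \<le> sin (pi * u / 2)"
    using assms by (intro half_le_sin) (auto simp: field_simps)
  moreover have "2 * u \<le> pi * u"
    using assms pi_ge_two by (intro mult_right_mono) auto
  ultimately show "u / 2 \<le> sin (pi * u / 2)"
    by simp
qed

lemma exp_arc_log:
  assumes "0 < u" "u \<le> 1"
  shows "exp (arc_log u) = part_circlepath (1/2) (1/2) (- pi) 0 u"
proof -
  have e: "pi * (u - 1) / 2 = pi * u / 2 - pi / 2"
    by (simp add: field_simps)
  show ?thesis
    unfolding semicircle_eq arc_log_def exp_eq_polar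
    using sin_half_pi_pos [OF assms]
    by (simp add: complex_eq_iff e cos_diff sin_diff power2_eq_square)
qed

lemma Ln_semicircle:
  assumes "0 < u" "u \<le> 1"
  shows "Ln (part_circlepath (1/2) (1/2) (- pi) 0 u) = arc_log u"
proof -
  have *: "0 < q \<Longrightarrow> q \<le> pi \<Longrightarrow> - pi < (q - pi) / 2 \<and> (q - pi) / 2 \<le> pi" for q :: real
    using pi_gt_zero by (auto simp: field_simps)
  have q: "0 < pi * u" "pi * u \<le> pi"
    using assms by auto
  have "Im (arc_log u) = (pi * u - pi) / 2"
    by (simp add: arc_log_def right_diff_distrib)
  with * [OF q] have "- pi < Im (arc_log u)" "Im (arc_log u) \<le> pi"
    by (simp_all only:)
  then show ?thesis
    by (metis Ln_exp exp_arc_log [OF assms])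
qed

lemma arc_log_vector_derivative:
  assumes u: "0 < u" "u < 1"
  shows "(arc_log has_vector_derivative
     of_real (pi / 2) * (- \<i>) * (Complex (cos (pi * u / 2)) (sin (pi * u / 2)))\<^sup>2 / part_circlepath (1/2) (1/2) (- pi) 0 u) (at u)"
proof -
  define s c where "s = sin (pi * u / 2)" and "c = cos (pi * u / 2)"
  have s: "s > 0" using sin_half_pi_pos [of u] u by (simp add: s_def)
  have sc: "c * c = 1 - s * s"
    using sin_cos_squared_add [of "pi * u / 2"] by (simp add: s_def c_def power2_eq_square algebra_simps)
  have "((\<lambda>u. ln (sin (pi * u / 2))) has_real_derivative (pi / 2 * (c / s))) (at u)"
    using s by (auto intro!: derivative_eq_intros simp: s_def c_def field_simps)
  moreover have "((\<lambda>u. pi * (u - 1) / 2) has_real_derivative (pi / 2)) (at u)"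
    by (auto intro!: derivative_eq_intros)
  ultimately have "(arc_log has_vector_derivative Complex (pi / 2 * (c / s)) (pi / 2)) (at u)"
    unfolding arc_log_def
    by (simp add: has_vector_derivative_complex_iff)
  also have "Complex (pi / 2 * (c / s)) (pi / 2)
     = of_real (pi / 2) * (- \<i>) * (Complex c s)\<^sup>2 / Complex (s\<^sup>2) (- s * c)"
  proof -
    have nz: "Complex (s\<^sup>2) (- s * c) \<noteq> 0"
      using s by (simp add: complex_eq_iff)
    have "Complex (pi / 2 * (c / s)) (pi / 2) * Complex (s\<^sup>2) (- s * c) = of_real (pi / 2) * (- \<i>) * (Complex c s)\<^sup>2"
      using s sc by (simp add: complex_eq_iff power2_eq_square field_simps)
    then show ?thesis
      by (simp only: nonzero_eq_divide_eq [OF nz])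
  qed
  finally show ?thesis
    unfolding semicircle_eq by (simp only: s_def c_def)
qed

lemma semicircle_eq_real:
  assumes "0 \<le> u" "u \<le> 1" "part_circlepath (1/2) (1/2) (- pi) 0 u = of_real r"
  shows "r = 0 \<or> r = 1"
proof -
  let ?s = "sin (pi * u / 2)" and ?c = "cos (pi * u / 2)"
  have "r = ?s\<^sup>2" "?s = 0 \<or> ?c = 0"
    using assms(3) unfolding semicircle_eq by (auto simp: complex_eq_iff)
  moreover have "?s\<^sup>2 + ?c\<^sup>2 = 1"
    by (rule sin_cos_squared_add)
  ultimately show ?thesis
    by (elim disjE) simp_all
qed

text \<open>Since \<open>a > 1\<close>, the poles \<open>1/a\<close> and \<open>-1/a\<close> lie off the path and \<open>f\<close> is bounded. Modulus and argument of the
path both tend monotonically to those of \<open>1\<close>, so both parts of the logarithm decrease in absolute value.\<close>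

lemma semicircle_log_path_form:
  assumes z: "z = of_real a \<or> z = - of_real a" and a: "a > 1"
  shows "\<exists>C D. log_path_form arc_log (\<lambda>u. of_real (pi / 2) * (- \<i>) * (Complex (cos (pi * u / 2)) (sin (pi * u / 2)))\<^sup>2
             / (part_circlepath (1/2) (1/2) (- pi) 0 u - 1 / z)) C D"
proof -
  let ?\<gamma> = "part_circlepath (1/2) (1/2) (- pi) 0"
  define f where "f = (\<lambda>u. of_real (pi / 2) * (- \<i>) * (Complex (cos (pi * u / 2)) (sin (pi * u / 2)))\<^sup>2
             / (?\<gamma> u - 1 / z))"
  have ne: "?\<gamma> u - 1 / z \<noteq> 0" if u: "u \<in> {0..1}" for u
  proof
    assume "?\<gamma> u - 1 / z = 0"
    then have "?\<gamma> u = of_real (1 / a) \<or> ?\<gamma> u = of_real (- 1 / a)"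
      using z by auto
    then have "1 / a = 0 \<or> 1 / a = 1 \<or> - 1 / a = 0 \<or> - 1 / a = 1"
      using semicircle_eq_real [of u "1 / a"] semicircle_eq_real [of u "- 1 / a"] u by auto
    then show False using a by (auto simp: field_simps)
  qed
  have fc: "continuous_on {0..1} f"
    unfolding f_def Complex_eq using ne
    by (intro continuous_intros continuous_on_subset [OF path_part_circlepath [unfolded path_def]]) auto
  then have "bounded (f ` {0..1})"
    by (intro compact_imp_bounded compact_continuous_image) auto
  then obtain M where M: "M > 0" "\<And>u. u \<in> {0..1} \<Longrightarrow> norm (f u) \<le> M"
    unfolding bounded_pos by auto
  (* From sin (pi * u / 2) >= u / 2 the real part is at most ln 2 - ln u in absolute value. *)
  define C where "C = 1 + ln 2 + pi"
  have C: "C \<ge> 1" by (simp add: C_def)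
  have Lb: "norm (arc_log u) \<le> C * (1 - ln u)" if u: "0 < u" "u < 1" for u
  proof -
    let ?s = "sin (pi * u / 2)"
    have s: "0 < ?s" "u / 2 \<le> ?s"
      using sin_half_pi_pos [of u] u by auto
    have lu: "ln u < 0" using u by simp
    have "ln (u / 2) \<le> ln ?s" using s u by (subst ln_le_cancel_iff) auto
    moreover have "ln ?s \<le> 0" using s by (subst ln_le_zero_iff) auto
    moreover have "ln (u / 2) = ln u - ln 2" using u by (simp add: ln_div)
    ultimately have "\<bar>ln ?s\<bar> \<le> ln 2 - ln u"
      by linarith
    moreover have "\<bar>pi * (u - 1) / 2\<bar> \<le> pi"
    proof -
      have "\<bar>pi * (u - 1) / 2\<bar> = pi * ((1 - u) / 2)"
        using u by (simp add: abs_mult)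
      also have "\<dots> \<le> pi * 1"
        using u by (intro mult_left_mono) auto
      finally show ?thesis by simp
    qed
    ultimately have "norm (arc_log u) \<le> (ln 2 - ln u) + pi"
      using cmod_le [of "arc_log u"] by (simp add: arc_log_def)
    also have "\<dots> \<le> C + (- ln u) * 1" by (simp add: C_def)
    also have "\<dots> \<le> C + (- ln u) * C" using lu C by (intro add_mono mult_left_mono) auto
    finally show ?thesis by (simp add: algebra_simps)
  qed
  have "log_path_form arc_log f C (M * C)"
  proof
    have c: "isCont arc_log u" if "0 < u" "u \<le> 1" for u
      unfolding arc_log_def Complex_eq using sin_half_pi_pos [OF that] by (intro continuous_intros) auto
    then show "continuous_on {0<..<1} arc_log"
      by (auto intro!: continuous_at_imp_continuous_on)
    show "continuous_on {0..<1} f"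
      using fc by (rule continuous_on_subset) auto
    show "norm (arc_log u) \<le> C * (1 - ln u)" if "0 < u" "u < 1" for u
      using that by (rule Lb)
    show "norm (f u * arc_log u) \<le> M * C * (1 - ln u)" if u: "0 < u" "u < 1" for u
    proof -
      have "norm (f u) * norm (arc_log u) \<le> M * (C * (1 - ln u))"
        using M(2) [of u] Lb [OF u] u M(1) by (intro mult_mono) auto
      then show ?thesis by (simp add: norm_mult mult.assoc)
    qed
    show "norm (arc_log v) \<le> norm (arc_log u)" if uv: "0 < u" "u \<le> v" "v < 1" for u v
    proof -
      have "sin (pi * u / 2) \<le> sin (pi * v / 2)"
        using uv by (intro sin_monotone_2pi_le) (auto simp: field_simps intro: order_trans [of _ "pi * 1"] order_trans [of _ 0])
      then have "ln (sin (pi * u / 2)) \<le> ln (sin (pi * v / 2))" "ln (sin (pi * v / 2)) \<le> 0"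
        using sin_half_pi_pos [of u] sin_half_pi_pos [of v] uv by (auto simp: ln_le_zero_iff)
      then have "(ln (sin (pi * v / 2)))\<^sup>2 \<le> (ln (sin (pi * u / 2)))\<^sup>2"
        by (intro abs_le_square_iff [THEN iffD1]) auto
      moreover have "(pi * (v - 1) / 2)\<^sup>2 \<le> (pi * (u - 1) / 2)\<^sup>2"
        using uv by (intro abs_le_square_iff [THEN iffD1]) (auto simp: abs_mult)
      ultimately show ?thesis
        by (simp add: arc_log_def cmod_def)
    qed
    have "(arc_log \<longlongrightarrow> arc_log 1) (at_left 1)"
      using c [of 1] by (auto simp: isCont_def intro: tendsto_within_subset)
    moreover show "arc_log 1 = 0"
      by (simp add: arc_log_def complex_eq_iff)
    ultimately show "(arc_log \<longlongrightarrow> 0) (at_left 1)"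
      by simp
  qed
  then show ?thesis unfolding f_def by blast
qed

section \<open>Moving the semicircle to the segment\<close>

text \<open>Cauchy's theorem in the right half-plane. As both paths start on its boundary, a primitive \<open>G\<close> is
compared near the start: by the integrals, \<open>G\<close> tends to \<open>G 1 - A\<close> along the semicircle and to \<open>G 1 - B\<close>
along the segment. A point \<open>p\<close> of the semicircle is joined to \<open>Re p\<close> by a vertical segment, which is short
compared with the growth of \<open>g\<close>: its length is at most \<open>norm p = sqrt (Re p)\<close>, and on it \<open>g\<close> is bounded by a
constant times \<open>(b - ln (Re p))\<^sup>2\<close>.\<close>

lemma semicircle_deform:
  fixes g :: "complex \<Rightarrow> complex"
  defines "\<gamma> \<equiv> part_circlepath (1/2) (1/2) (- pi) 0"
  assumes hol: "g holomorphic_on {t. Re t > 0}"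
    and A: "((\<lambda>u. vector_derivative \<gamma> (at u within {0..1}) * g (\<gamma> u)) has_integral A) {0..1}"
    and B: "((\<lambda>x. g (of_real x)) has_integral B) {0..1}"
    and bound: "\<delta> > 0" "\<And>t. Re t > 0 \<Longrightarrow> norm t < \<delta> \<Longrightarrow> norm (g t) \<le> M * (b - ln (Re t)) ^ 2"
  shows "A = B"
proof -
  define H where "H = {t. Re t > 0}"
  have H: "open H" "convex H"
    unfolding H_def by (auto simp: open_halfspace_Re_gt convex_halfspace_Re_gt)
  obtain G where G: "\<And>t. t \<in> H \<Longrightarrow> (G has_field_derivative g t) (at t within H)"
    using holomorphic_convex_primitive' [OF H(2,1) hol [folded H_def]] by blast
  then have G': "(G has_field_derivative g t) (at t)" if "t \<in> H" for t
    using G [OF that] at_within_open [OF that H(1)] by simp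
  have \<gamma>H: "\<gamma> u \<in> H" if "0 < u" "u \<le> 1" for u
    unfolding H_def \<gamma>_def semicircle_eq using sin_half_pi_pos [OF that] by simp
  have \<gamma>': "(\<gamma> has_vector_derivative vector_derivative \<gamma> (at u within {0..1})) (at u)" if "0 < u" "u < 1" for u
    unfolding \<gamma>_def using that has_vector_derivative_part_circlepath [of "1/2" "1/2" "- pi" 0 u UNIV]
    by (subst vector_derivative_part_circlepath01) simp_all
  have tail: "((\<lambda>e. G (p e)) \<longlongrightarrow> G (p 1) - I) (at_right 0)"
    if p: "continuous_on {0..1} p" "\<And>u. 0 < u \<Longrightarrow> u \<le> 1 \<Longrightarrow> p u \<in> H"
      "\<And>u. 0 < u \<Longrightarrow> u < 1 \<Longrightarrow> (p has_vector_derivative p' u) (at u)"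
      and I: "((\<lambda>u. p' u * g (p u)) has_integral I) {0..1}" for p p' :: "real \<Rightarrow> complex" and I
  proof -
    let ?h = "\<lambda>u. p' u * g (p u)"
    have "continuous_on {0..1} (\<lambda>x. integral {x..1} ?h)"
      using I by (intro indefinite_integral_continuous_1') blast
    then have "((\<lambda>x. integral {x..1} ?h) \<longlongrightarrow> integral {0..1} ?h) (at_right 0)"
      by (auto dest: continuous_on_Icc_at_rightD)
    then have "((\<lambda>x. G (p 1) - integral {x..1} ?h) \<longlongrightarrow> G (p 1) - I) (at_right 0)"
      using integral_unique [OF I] by (intro tendsto_intros) simp
    moreover have "\<forall>\<^sub>F x in at_right (0::real). G (p 1) - integral {x..1} ?h = G (p x)"
    proof (rule eventually_at_rightI [of 0 1])
      fix x :: real assume x: "x \<in> {0<..<1}"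
      have "(?h has_integral (G \<circ> p) 1 - (G \<circ> p) x) {x..1}"
      proof (rule fundamental_theorem_of_calculus_interior)
        have "continuous_on H G"
          using G by (meson DERIV_continuous continuous_on_eq_continuous_within)
        then show "continuous_on {x..1} (G \<circ> p)"
          using x p(2) by (intro continuous_on_compose continuous_on_subset [OF p(1)])
            (auto elim!: continuous_on_subset)
        show "((G \<circ> p) has_vector_derivative ?h u) (at u)" if "u \<in> {x<..<1}" for u
          using that x by (intro field_vector_diff_chain_at p(3) G' p(2)) auto
      qed (use x in auto)
      then show "G (p 1) - integral {x..1} ?h = G (p x)"
        by (simp add: integral_unique)
    qed auto
    ultimately show ?thesis
      by (rule Lim_transform_eventually)
  qed
  have \<gamma>1: "\<gamma> 1 = 1"
    unfolding \<gamma>_def semicircle_eq by (simp add: complex_eq_iff)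
  have TA: "((\<lambda>e. G (\<gamma> e)) \<longlongrightarrow> G 1 - A) (at_right 0)"
    using tail [OF _ \<gamma>H \<gamma>' A] \<gamma>1 path_part_circlepath [unfolded path_def] by (simp add: \<gamma>_def)
  have TB: "((\<lambda>e. G (of_real e)) \<longlongrightarrow> G 1 - B) (at_right 0)"
    using tail [of of_real "\<lambda>_. 1" B] B
    by (auto simp: H_def continuous_on_of_real_id intro!: has_vector_derivative_of_real [of "\<lambda>x. x" 1, simplified])
  have \<gamma>0: "(\<gamma> \<longlongrightarrow> 0) (at_right 0)"
  proof -
    have "(\<gamma> \<longlongrightarrow> \<gamma> 0) (at_right 0)"
      unfolding \<gamma>_def by (rule continuous_on_Icc_at_rightD [OF path_part_circlepath [unfolded path_def]]) simp
    also have "\<gamma> 0 = 0"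
      unfolding \<gamma>_def semicircle_eq by (simp add: complex_eq_iff)
    finally show ?thesis .
  qed
  have ev: "\<forall>\<^sub>F u in at_right (0::real). u \<in> {0<..<1}"
    by (rule eventually_at_rightI [of 0 1]) auto
  have R0: "filterlim (\<lambda>u. Re (\<gamma> u)) (at_right 0) (at_right 0)"
  proof (rule tendsto_imp_filterlim_at_right)
    show "((\<lambda>u. Re (\<gamma> u)) \<longlongrightarrow> 0) (at_right 0)"
      using tendsto_Re [OF \<gamma>0] by simp
    show "\<forall>\<^sub>F u in at_right 0. 0 < Re (\<gamma> u)"
      using ev by eventually_elim (use \<gamma>H in \<open>auto simp: H_def\<close>)
  qed
  have sq: "norm (\<gamma> u) = sqrt (Re (\<gamma> u))" "Re (\<gamma> u) \<le> norm (\<gamma> u)" for u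
  proof -
    let ?s = "sin (pi * u / 2)" and ?c = "cos (pi * u / 2)"
    have "?s\<^sup>2 * ?s\<^sup>2 + ?s\<^sup>2 * ?c\<^sup>2 = ?s\<^sup>2 * (?s\<^sup>2 + ?c\<^sup>2)"
      by (simp only: distrib_left)
    also have "\<dots> = ?s\<^sup>2" by (simp only: sin_cos_squared_add mult_1_right)
    finally show "norm (\<gamma> u) = sqrt (Re (\<gamma> u))"
      unfolding \<gamma>_def semicircle_eq
      by (simp add: cmod_def power_mult_distrib power2_eq_square mult_ac)
    show "Re (\<gamma> u) \<le> norm (\<gamma> u)" by (rule complex_Re_le_cmod)
  qed
  have D0: "((\<lambda>u. G (\<gamma> u) - G (of_real (Re (\<gamma> u)))) \<longlongrightarrow> 0) (at_right 0)"
  proof (rule Lim_null_comparison)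
    have "((\<lambda>x. (b - ln x) ^ 2 * sqrt x) \<longlongrightarrow> 0) (at_right 0)"
      by real_asymp
    from filterlim_compose [OF tendsto_mult_left [OF this, of M] R0]
    show "((\<lambda>u. M * ((b - ln (Re (\<gamma> u))) ^ 2 * sqrt (Re (\<gamma> u)))) \<longlongrightarrow> 0) (at_right 0)"
      by simp
    have "\<forall>\<^sub>F u in at_right 0. dist (\<gamma> u) 0 < \<delta>"
      using \<gamma>0 bound(1) by (rule tendstoD)
    then show "\<forall>\<^sub>F u in at_right 0. norm (G (\<gamma> u) - G (of_real (Re (\<gamma> u))))
        \<le> M * ((b - ln (Re (\<gamma> u))) ^ 2 * sqrt (Re (\<gamma> u)))"
      using ev
    proof eventually_elim
      case (elim u)
      define x where "x = Re (\<gamma> u)"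
      have x: "x > 0" using \<gamma>H [of u] elim by (simp add: x_def H_def)
      define S where "S = {t. Re t = x \<and> norm t < \<delta>}"
      have cS: "convex S"
      proof -
        have "S = {t. Re t = x} \<inter> ball 0 \<delta>" by (auto simp: S_def)
        moreover have "convex {t. Re t = x}"
          using convex_hyperplane [of "1 :: complex" x] by (simp add: inner_complex_def)
        ultimately show ?thesis by (simp add: convex_Int)
      qed
      have SH: "S \<subseteq> H" using x by (auto simp: S_def H_def)
      have "norm (G (\<gamma> u) - G (of_real x)) \<le> M * (b - ln x) ^ 2 * norm (\<gamma> u - of_real x)"
      proof (rule field_differentiable_bound [OF cS])
        show "(G has_field_derivative g t) (at t within S)" if "t \<in> S" for t
          using G' SH that by (blast intro: has_field_derivative_at_within)
        show "norm (g t) \<le> M * (b - ln x) ^ 2" if "t \<in> S" for t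
          using bound(2) [of t] that x by (simp add: S_def)
        show "\<gamma> u \<in> S" using elim by (simp add: S_def x_def)
        show "of_real x \<in> S" using elim sq(2) [of u] x by (simp add: S_def x_def)
      qed
      also have "\<dots> \<le> M * (b - ln x) ^ 2 * sqrt x"
      proof (rule mult_left_mono)
        have "norm (\<gamma> u - of_real x) = \<bar>Im (\<gamma> u)\<bar>"
          by (simp add: x_def cmod_def)
        also have "\<dots> \<le> norm (\<gamma> u)" by (rule abs_Im_le_cmod)
        finally show "norm (\<gamma> u - of_real x) \<le> sqrt x" by (simp add: sq x_def)
        have "of_real x \<in> S" using elim sq(2) [of u] x by (simp add: S_def x_def)
        then have "0 \<le> norm (g (of_real x))" "norm (g (of_real x)) \<le> M * (b - ln x) ^ 2"
          using bound(2) [of "of_real x"] x by (auto simp: S_def)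
        then show "0 \<le> M * (b - ln x) ^ 2" by linarith
      qed
      finally show ?case by (simp add: x_def mult.assoc)
    qed
  qed
  have "((\<lambda>u. G (of_real (Re (\<gamma> u)))) \<longlongrightarrow> G 1 - B) (at_right 0)"
    using TB R0 by (rule filterlim_compose)
  from tendsto_diff [OF TA this] have "((\<lambda>u. G (\<gamma> u) - G (of_real (Re (\<gamma> u)))) \<longlongrightarrow> B - A) (at_right 0)"
    by simp
  from tendsto_unique [OF _ this D0] show "A = B"
    by simp
qed

text \<open>The removable singularity of the kernel, moved from \<open>1/a\<close> to \<open>1\<close> by \<open>w = a t\<close>.\<close>

lemma holomorphic_Ln_div: "(\<lambda>w. if w = 1 then 1 else Ln w / (w - 1)) holomorphic_on {w. Re w > 0}"
proof -
  have "(\<lambda>w. if w = 1 then deriv Ln 1 else Ln w / (w - 1) - Ln 1 / (w - 1)) holomorphic_on {w. Re w > 0}"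
  proof (rule pole_theorem_open)
    show "Ln holomorphic_on {w. Re w > 0}"
      by (intro holomorphic_intros) (auto simp: complex_nonpos_Reals_iff)
    show "open {w. Re w > 0}" by (rule open_halfspace_Re_gt)
  qed auto
  moreover have d: "deriv Ln 1 = (1 :: complex)"
    using has_field_derivative_Ln [of 1] by (intro DERIV_imp_deriv) auto
  ultimately show ?thesis
    unfolding d Ln_1 by (simp only: div_0 diff_zero)
qed

text \<open>The function \<open>g\<close> is the kernel on the right half-plane with the singularity at \<open>1/a\<close> removed. Its
integral along the semicircle is a quarter of the left-hand side, by \<open>odd_polylog_has_integral\<close>, and along the
segment it is \<open>I\<close>.\<close>

lemma odd_polylog_gt_one:
  assumes a: "a > 1" and I: "(log_kernel a has_integral I) {0..1}"
  shows "4 * odd_polylog a 3 1 - 2 * odd_polylog_log a 2 1 = of_real (4 * I)"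
proof -
  define \<gamma> where "\<gamma> = part_circlepath (1/2) (1/2) (- pi) 0"
  define d where "d = (\<lambda>u. of_real (pi / 2) * (- \<i>) * (Complex (cos (pi * u / 2)) (sin (pi * u / 2)))\<^sup>2)"
  let ?a = "complex_of_real a"
  define h where "h = (\<lambda>w. if w = 1 then 1 else Ln w / (w - 1))"
  define g where "g = (\<lambda>t. - (?a * Ln t * h (?a * t) / (?a * t + 1)))"
  have d: "vector_derivative \<gamma> (at u within {0..1}) = d u" if "u \<in> {0..1}" for u
    using semicircle_vector_derivative [OF that] by (simp add: \<gamma>_def d_def)
  have Ln_a: "Ln (?a * t) = of_real (ln a) + Ln t" if "t \<noteq> 0" for t
    using a that by (subst Ln_times_of_real) (auto simp: Ln_of_real)
  have g_eq: "g t = ?a * Ln t * (of_real (ln a) + Ln t) / (1 - (?a * t)\<^sup>2)"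
    if t: "Re t > 0" "?a * t \<noteq> 1" for t
  proof -
    have "t \<noteq> 0" using t by auto
    have "g t = - (?a * Ln t * (of_real (ln a) + Ln t) / ((?a * t - 1) * (?a * t + 1)))"
      using t(2) Ln_a [OF \<open>t \<noteq> 0\<close>] by (simp add: g_def h_def)
    also have "(?a * t - 1) * (?a * t + 1) = - (1 - (?a * t)\<^sup>2)"
      by (simp add: algebra_simps power2_eq_square)
    finally show ?thesis by (simp only: divide_minus_right minus_minus)
  qed
  obtain C D where F1: "log_path_form arc_log (\<lambda>u. d u / (\<gamma> u - 1 / ?a)) C D"
    using semicircle_log_path_form [of ?a a] a by (auto simp: d_def \<gamma>_def)
  obtain C' D' where F2: "log_path_form arc_log (\<lambda>u. d u / (\<gamma> u - 1 / (- ?a))) C' D'"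
    using semicircle_log_path_form [of "- ?a" a] a by (auto simp: d_def \<gamma>_def)
  have ne: "?a * \<gamma> u \<noteq> 1 \<and> ?a * \<gamma> u \<noteq> -1" if u: "0 < u" "u < 1" for u
  proof -
    have "\<gamma> u \<noteq> of_real (1 / a)" "\<gamma> u \<noteq> of_real (- 1 / a)"
      using semicircle_eq_real [of u "1 / a"] semicircle_eq_real [of u "- 1 / a"] u a
      by (auto simp: \<gamma>_def field_simps)
    moreover have "\<gamma> u = of_real (1 / a)" if "?a * \<gamma> u = 1"
      using that a by (simp add: field_simps)
    moreover have "\<gamma> u = of_real (- 1 / a)" if "?a * \<gamma> u = - 1"
      using that a by (simp add: field_simps)
    ultimately show ?thesis by blast
  qed
  let ?R = "4 * odd_polylog a 3 1 - 2 * odd_polylog_log a 2 1"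
  have R4: "((\<lambda>u. 4 * (d u * (?a * arc_log u * (of_real (ln a) + arc_log u) / (1 - (?a * \<gamma> u)\<^sup>2)))) has_integral ?R) {0..1}"
  proof (rule odd_polylog_has_integral [OF _ _ d _ F1 F2 ne])
    show "polylog_path ?a = \<gamma>"
      using a by (subst polylog_path_of_real) (auto simp: \<gamma>_def)
    show "(arc_log has_vector_derivative d u / \<gamma> u) (at u)" if "0 < u" "u < 1" for u
      using arc_log_vector_derivative [OF that] by (simp add: d_def \<gamma>_def)
  qed (use a in auto)
  have four: "4 * x / 4 = x" for x :: complex
    by simp
  from has_integral_divide [OF R4, of 4]
  have "((\<lambda>u. d u * (?a * arc_log u * (of_real (ln a) + arc_log u) / (1 - (?a * \<gamma> u)\<^sup>2))) has_integral ?R / 4) {0<..<1}"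
    by (simp only: four has_integral_Icc_iff_Ioo)
  then have "((\<lambda>u. vector_derivative \<gamma> (at u within {0..1}) * g (\<gamma> u)) has_integral ?R / 4) {0<..<1}"
  proof (rule has_integral_eq [rotated])
    fix u :: real assume u: "u \<in> {0<..<1}"
    then have "Re (\<gamma> u) > 0" "Ln (\<gamma> u) = arc_log u"
      using Ln_semicircle [of u] sin_half_pi_pos [of u] by (auto simp: \<gamma>_def semicircle_eq)
    then show "d u * (?a * arc_log u * (of_real (ln a) + arc_log u) / (1 - (?a * \<gamma> u)\<^sup>2))
        = vector_derivative \<gamma> (at u within {0..1}) * g (\<gamma> u)"
      using g_eq [of "\<gamma> u"] ne [of u] d [of u] u by simp
  qed
  then have A: "((\<lambda>u. vector_derivative \<gamma> (at u within {0..1}) * g (\<gamma> u)) has_integral ?R / 4) {0..1}"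
    by (simp only: has_integral_Icc_iff_Ioo)
  have B: "((\<lambda>x. g (of_real x)) has_integral of_real I) {0..1}"
  proof (rule has_integral_spike_finite [where S = "{0, 1 / a}"])
    show "((\<lambda>x. complex_of_real (log_kernel a x)) has_integral of_real I) {0..1}"
      by (rule has_integral_of_real [OF I])
    fix x assume x: "x \<in> {0..1} - {0, 1 / a}"
    then have "x > 0" "a * x \<noteq> 1" using a by (auto simp: field_simps)
    then have "complex_of_real (a * x) \<noteq> 1" by (metis of_real_eq_1_iff)
    with \<open>x > 0\<close> show "g (of_real x) = complex_of_real (log_kernel a x)"
      by (subst g_eq) (auto simp: log_kernel_def Ln_of_real power_mult_distrib)
  qed simp
  have hol: "g holomorphic_on {t. Re t > 0}"
  proof -
    have "(h \<circ> (\<lambda>t. ?a * t)) holomorphic_on {t. Re t > 0}"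
      unfolding h_def using a
      by (intro holomorphic_on_compose_gen [OF _ holomorphic_Ln_div] holomorphic_intros) auto
    moreover have "?a * t + 1 \<noteq> 0" if "Re t > 0" for t
    proof -
      have "Re (?a * t + 1) > 0" using a that by (simp add: add_pos_pos)
      then show ?thesis by (metis less_irrefl zero_complex.sel(1))
    qed
    ultimately show ?thesis
      unfolding g_def o_def
      by (intro holomorphic_intros) (auto simp: complex_nonpos_Reals_iff)
  qed
  (* For |a t| < 1/2 the two factors of the denominator are at least 1/2 and 1. *)
  have bound: "norm (g t) \<le> (2 * a) * ((pi + ln a) - ln (Re t)) ^ 2"
    if t: "Re t > 0" "norm t < 1 / (2 * a)" for t
  proof -
    have t0: "t \<noteq> 0" "norm t > 0" using t by auto
    have at: "norm (?a * t) < 1 / 2"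
      using t a by (simp add: norm_mult field_simps)
    have lnt: "norm (Ln t) \<le> pi - ln (Re t)"
    proof -
      have "norm t < 1" 
      proof -
        have "1 / (2 * a) < 1" using a by (simp add: field_simps)
        with t(2) show ?thesis by linarith
      qed
      then have "ln (norm t) \<le> 0" using t0 by (simp add: ln_le_zero_iff)
      moreover have "ln (Re t) \<le> ln (norm t)"
        using t complex_Re_le_cmod [of t] t0 by (subst ln_le_cancel_iff) auto
      moreover have "norm (Ln t) \<le> \<bar>ln (norm t)\<bar> + pi"
        using t0(1) cmod_le [of "Ln t"] Im_Ln_le_pi [OF t0(1)] mpi_less_Im_Ln [OF t0(1)] Re_Ln [OF t0(1)]
        by linarith
      ultimately show ?thesis by linarith
    qed
    have la: "ln a > 0" using a by simp
    have n1: "norm (?a * t - 1) \<ge> 1 / 2"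
      using at norm_triangle_ineq2 [of 1 "?a * t"] by (simp add: norm_minus_commute)
    have n2: "norm (?a * t + 1) \<ge> 1"
    proof -
      have "1 \<le> Re (?a * t + 1)" using a t by simp
      then show ?thesis using complex_Re_le_cmod [of "?a * t + 1"] by linarith
    qed
    have "?a * t \<noteq> 1"
      using n1 by auto
    then have "norm (g t) = a * norm (Ln t) * norm (of_real (ln a) + Ln t) / (norm (?a * t - 1) * norm (?a * t + 1))"
      using a Ln_a [OF t0(1)] by (simp add: g_def h_def norm_mult norm_divide)
    also have "\<dots> \<le> a * norm (Ln t) * norm (of_real (ln a) + Ln t) / (1 / 2 * 1)"
      using n1 n2 a by (intro divide_left_mono mult_mono mult_pos_pos mult_nonneg_nonneg) auto
    also have "\<dots> = 2 * a * (norm (Ln t) * norm (of_real (ln a) + Ln t))"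
      by simp
    also have "\<dots> \<le> 2 * a * (((pi + ln a) - ln (Re t)) * ((pi + ln a) - ln (Re t)))"
    proof (intro mult_left_mono mult_mono)
      show "norm (Ln t) \<le> (pi + ln a) - ln (Re t)" using lnt la by linarith
      show "norm (of_real (ln a) + Ln t) \<le> (pi + ln a) - ln (Re t)"
        using norm_triangle_ineq [of "of_real (ln a)" "Ln t"] lnt la by simp
      show "0 \<le> (pi + ln a) - ln (Re t)" using lnt la norm_ge_zero [of "Ln t"] by linarith
    qed (use a in auto)
    finally show ?thesis by (simp add: power2_eq_square)
  qed
  have "?R / 4 = of_real I"
    by (rule semicircle_deform [OF hol A [unfolded \<gamma>_def] B _ bound]) (use a in auto)
  then show ?thesis by (simp add: field_simps)
qed

text \<open>The series is used only for \<open>a < 1\<close>, where the polylogarithms are defined by it.\<close>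

theorem theorem13:
  fixes a :: real
  assumes "a > 0"
  shows "of_real (pi ^ 2 *
           (let w = Var 1; x = Var 2; y = Var 3 :: 3 cpoly
            in mahler_measure
                 ((1 + w) * (1 + x) + Const (of_real a) * (1 - w) * (1 - x) * y)))
         = 4 * odd_polylog a 3 1 - 2 * odd_polylog_log a 2 1"
proof -
  define I where "I = integral {0..1} (log_kernel a)"
  have I: "(log_kernel a has_integral I) {0..1}"
    unfolding I_def by (rule integrable_integral [OF log_kernel_integrable [OF assms]])
  have "4 * odd_polylog a 3 1 - 2 * odd_polylog_log a 2 1 = of_real (4 * I)"
  proof (cases "a < 1")
    case True
    have I_eq: "I = 2 * legendre_chi 3 a - ln a * legendre_chi 2 a"
      using I has_integral_log_kernel_series [OF assms True] by (rule has_integral_unique)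
    have "odd_polylog a 3 1 = of_real (2 * legendre_chi 3 a)"
      "odd_polylog_log a 2 1 = of_real (ln a * (2 * legendre_chi 2 a))"
      using polylog_series_odd [OF assms True] assms
      by (simp_all add: odd_polylog_def odd_polylog_log_def Let_def)
    then show ?thesis
      by (simp only: I_eq of_real_mult of_real_diff) (simp add: algebra_simps)
  next
    case False
    then show ?thesis
      using odd_polylog_one odd_polylog_gt_one I by (cases "a = 1") auto
  qed
  then show ?thesis
    using mahler_measure_eq_integral_log_kernel [OF assms I] by (simp add: Let_def)
qed

end
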